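(* Let $p$ be an odd prime. (i) $$T_p(1,-1,-1)\equiv\begin{cases}-5^{(p-1)/4}\pmod p&\text{if }p\equiv1,9\pmod{20},\\ (-5)^{(p-1)/4}\pmod p&\text{if }p\equiv13,17\pmod{20},\\ (-1)^{\lfloor(p-10)/20\rfloor}\pmod p&\text{if }p\equiv3,7\pmod{20},\\ (-1)^{\lfloor(p-5)/10\rfloor}\pmod p&\text{if }p\equiv11,19\pmod{20}.\end{cases}$$ (ii) $$T_p(1,-2,-1)\equiv\begin{cases}-2^{(p-1)/4}\pmod p&\text{if }p\equiv1\pmod8,\\ 2^{(p-1)/4}\pmod p&\text{if }p\equiv5\pmod8,\\ (-1)^{(p-3)/8}\pmod p&\text{if }p\equiv3\pmod8,\\ (-1)^{(p-7)/8}\pmod p&\text{if }p\equiv7\pmod8.\end{cases}$$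
   Context: For an odd prime $p$ and $a,b,c\in\mathbb{Z}$, $T_p(a,b,c)=\prod_{i,j=1,\ p\nmid ai^2+bij+cj^2}^{(p-1)/2}(ai^2+bij+cj^2)$. *)

theory Defs
  imports "HOL-Number_Theory.Number_Theory"
begin

definition T :: "nat \<Rightarrow> int \<Rightarrow> int \<Rightarrow> int \<Rightarrow> int" where
  "T p a b c = (\<Prod>(i,j) \<in> {(i,j). i \<in> {1..(p-1) div 2} \<and> j \<in> {1..(p-1) div 2}
       \<and> \<not> (int p dvd a * int i ^ 2 + b * int i * int j + c * int j ^ 2)}.
       a * int i ^ 2 + b * int i * int j + c * int j ^ 2)"

definition neg1_pow :: "int \<Rightarrow> int" where
  "neg1_pow k = (-1) ^ nat \<bar>k\<bar>"

end

theory Submission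
  imports Defs "HOL-Computational_Algebra.Polynomial"
begin

text \<open>
  Write \<open>p = 2n + 1\<close> and \<open>D = A\<^sup>2 + 4\<close>. For \<open>1 \<le> i, j \<le> n\<close> there is a unique residue \<open>B\<close> with
  \<open>i\<^sup>2 - B i j - j\<^sup>2 \<equiv> 0\<close>, and then \<open>i\<^sup>2 - A i j - j\<^sup>2 \<equiv> i j (B - A)\<close>. The pairs that belong to a
  given \<open>B\<close> are counted as in Gauss's lemma: if \<open>t\<close> and \<open>-1/t\<close> are the roots of \<open>x\<^sup>2 - B x - 1\<close>,
  then for each \<open>j \<le> n\<close> exactly one of \<open>t j\<close> and \<open>- t j\<close> has its residue in \<open>[1, n]\<close>. So there are
  \<open>n\<close> pairs if \<open>B\<^sup>2 + 4\<close> is a nonzero square, \<open>n/2\<close> if it vanishes, and none otherwise. Hence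
  \<open>T\<close> is, up to an explicit power of \<open>n!\<close> and of \<open>D\<close>, the product of the quadratic characters
  \<open>(B - A)\<^sup>n\<close> over \<open>X - {A}\<close>, where \<open>X\<close> is the set of \<open>B\<close> for which \<open>B\<^sup>2 + 4\<close> is a nonzero square.

  If \<open>D\<close> is a square, the involution \<open>B - A \<mapsto> D / (B - A)\<close> of \<open>X - {A}\<close> reduces this product to its
  fixed points. If \<open>D\<close> is not a square, \<open>X\<close> is the set of roots mod \<open>p\<close> of the Lucas polynomial
  \<open>V\<^sub>n\<close> (\<open>n\<close> odd) or \<open>U\<^sub>n\<close> (\<open>n\<close> even), and the product is governed by \<open>V\<^sub>n(A)\<close> or \<open>U\<^sub>n(A)\<close>.
  For \<open>n\<close> even \<open>U\<^sub>n(A)\<^sup>2 \<equiv> -1\<close>. For \<open>n\<close> odd everything comes down to \<open>(b + 2)\<^sup>n\<close> mod \<open>p\<close>, where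
  \<open>b\<close> is \<open>\<surd>2\<close> or the golden ratio; the recurrence \<open>w\<^sub>k\<^sub>+\<^sub>2 = b w\<^sub>k\<^sub>+\<^sub>1 - w\<^sub>k\<close> is then periodic, and
  applying \<open>(1 + E)\<^sup>p \<equiv> 1 + E\<^sup>p\<close> for the shift \<open>E\<close>, together with \<open>(1 + E)\<^sup>2 = (b + 2) E\<close>,
  evaluates it.
\<close>

section \<open>The quadratic form on the half system\<close>

text \<open>Ideal membership with explicit cofactors: a use supplies \<open>a\<close> and
  \<open>b\<close>, and only a polynomial identity remains to be checked.\<close>

lemma dvd_combination: "d dvd u \<Longrightarrow> d dvd v \<Longrightarrow> x = a * u + b * v \<Longrightarrow> d dvd x"
  for d u v x a b :: int
  by simp

lemma prod_atLeastAtMost_int: "\<Prod>{1..int k} = fact k"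
proof (induction k)
  case (Suc m)
  have "{1..int (Suc m)} = insert (int (Suc m)) {1..int m}" by auto
  then show ?case using Suc by simp
qed simp

locale odd_prime =
  fixes p n :: nat
  assumes prime_p: "prime p" and p_eq: "p = 2 * n + 1"
begin

abbreviation P :: int where "P \<equiv> int p"

abbreviation H :: "int set" where "H \<equiv> {1..int n}"

lemma P_eq: "P = 2 * int n + 1"
  using p_eq by simp

lemma P_pos: "P > 0"
  using P_eq by simp

lemma prime_P: "prime P"
  using prime_p by simp

lemma n_pos: "n > 0"
  using prime_p p_eq by (cases n) auto

lemma P_dvd_mult_iff: "P dvd a * b \<longleftrightarrow> P dvd a \<or> P dvd b"
  by (rule prime_dvd_mult_iff[OF prime_P])

lemma P_dvd_power_iff: "k > 0 \<Longrightarrow> P dvd a ^ k \<longleftrightarrow> P dvd a"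
  using prime_dvd_power_iff[OF prime_P, of k a] by simp

lemma not_dvd_small: "x \<noteq> 0 \<Longrightarrow> \<bar>x\<bar> < P \<Longrightarrow> \<not> P dvd x"
  using dvd_imp_le_int[of x P] by auto

lemma not_dvd_H: "j \<in> H \<Longrightarrow> \<not> P dvd j"
  using not_dvd_small[of j] P_eq by auto

lemma not_dvd_2: "\<not> P dvd 2"
  using not_dvd_small[of 2] P_eq n_pos by auto

lemma not_dvd_5: "p \<noteq> 5 \<Longrightarrow> \<not> P dvd 5"
  using primes_dvd_imp_eq[of p 5] prime_p by (auto simp: int_dvd_int_iff[of p 5, simplified])

lemma not_dvd_power_2: "\<not> P dvd 2 ^ k"
  using not_dvd_2 by (metis P_dvd_power_iff power_0 gr0I not_prime_unit prime_P dvd_1_iff_1 is_unit_power_iff)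

text \<open>The representative of \<open>\<plusminus> t j\<close> in \<open>[1, n]\<close>.\<close>

definition half_rep :: "int \<Rightarrow> int \<Rightarrow> int" where
  "half_rep t j = (if t * j mod P \<le> int n then t * j mod P else P - t * j mod P)"

lemma half_rep_mem:
  assumes "\<not> P dvd t" "j \<in> H"
  shows "half_rep t j \<in> H"
proof -
  have "\<not> P dvd t * j" using assms not_dvd_H P_dvd_mult_iff by blast
  then have "t * j mod P \<noteq> 0" by (simp add: mod_eq_0_iff_dvd)
  moreover have "0 \<le> t * j mod P" "t * j mod P < P"
    using P_pos pos_mod_sign pos_mod_bound by blast+
  ultimately show ?thesis using P_eq unfolding half_rep_def atLeastAtMost_iff
    by (cases "t * j mod P \<le> int n"; simp only: if_True if_False; linarith)
qed

lemma half_rep_cong: "P dvd half_rep t j - t * j \<or> P dvd half_rep t j + t * j"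
proof -
  have "P dvd t * j mod P - t * j" by (simp add: mod_eq_dvd_iff[symmetric])
  moreover from this have "P dvd P - t * j mod P + t * j"
    by (metis diff_diff_eq2 add.commute diff_add_eq dvd_diff dvd_refl)
  ultimately show ?thesis unfolding half_rep_def by auto
qed

text \<open>The heart of Gauss's lemma: equal representatives make \<open>t * x\<close> and
  \<open>t * y\<close> agree up to sign modulo \<open>P\<close>, and opposite signs are excluded
  because \<open>0 < x + y < P\<close> on \<open>H\<close>.\<close>

lemma inj_on_half_rep:
  assumes "\<not> P dvd t"
  shows "inj_on (half_rep t) H"
proof (rule inj_onI)
  fix x y assume xy: "x \<in> H" "y \<in> H" and eq: "half_rep t x = half_rep t y"
  have "P dvd t * (x - y) \<or> P dvd t * (x + y)"
  proof -
    let ?r = "half_rep t y"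
    have 1: "P dvd ?r - t * x \<or> P dvd ?r + t * x" using half_rep_cong[of t x] eq by simp
    have 2: "P dvd ?r - t * y \<or> P dvd ?r + t * y" using half_rep_cong[of t y] .
    have e: "t * (x - y) = (?r - t * y) - (?r - t * x)" "t * (x - y) = (?r + t * x) - (?r + t * y)"
      "t * (x + y) = (?r + t * x) - (?r - t * y)" "t * (x + y) = (?r + t * y) - (?r - t * x)"
      by (simp_all add: algebra_simps)
    show ?thesis using 1 2 e dvd_diff by metis
  qed
  then have "P dvd x - y \<or> P dvd x + y" using assms P_dvd_mult_iff by blast
  moreover have "\<not> P dvd x + y" using xy not_dvd_small[of "x + y"] P_eq by auto
  ultimately have "P dvd x - y" by blast
  moreover have "\<bar>x - y\<bar> < P" using xy P_eq by auto
  ultimately show "x = y" using not_dvd_small[of "x - y"] by auto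
qed

lemma bij_betw_half_rep:
  assumes "\<not> P dvd t"
  shows "bij_betw (half_rep t) H H"
  using endo_inj_surj[of H "half_rep t"] inj_on_half_rep[OF assms] half_rep_mem[OF assms]
  unfolding bij_betw_def by blast

section \<open>The pairs attached to one residue \<open>B\<close>, and their number\<close>

definition zeros :: "int \<Rightarrow> (int \<times> int) set" where
  "zeros B = {(i, j) \<in> H \<times> H. P dvd i^2 - B * i * j - j^2}"

lemma finite_zeros: "finite (zeros B)"
  by (rule finite_subset[of _ "H \<times> H"]) (auto simp: zeros_def)

lemma root_not_dvd: "P dvd t^2 - B * t - 1 \<Longrightarrow> \<not> P dvd t"
proof
  assume a: "P dvd t^2 - B * t - 1" "P dvd t"
  have "1 = t * (t - B) - (t^2 - B * t - 1)" by (simp add: algebra_simps power2_eq_square)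
  then have "P dvd 1" using a by (metis dvd_diff dvd_mult2)
  then show False using prime_P not_prime_unit by blast
qed

text \<open>The roots of \<open>x^2 - B x - 1\<close> are \<open>t\<close> and \<open>-1/t\<close>,
  so the form splits into \<open>i - t j\<close> and \<open>i + j/t\<close>; multiplying by the unit
  \<open>t\<close> avoids the inverse.\<close>

lemma zeros_factor:
  assumes "P dvd t^2 - B * t - 1"
  shows "P dvd i^2 - B * i * j - j^2 \<longleftrightarrow> P dvd i - t * j \<or> P dvd j + t * i"
proof -
  have "t * (i^2 - B * i * j - j^2) - (i - t * j) * (j + t * i) = (t^2 - B * t - 1) * (i * j)"
    by (simp add: algebra_simps power2_eq_square)
  then have "P dvd t * (i^2 - B * i * j - j^2) - (i - t * j) * (j + t * i)"
    using assms by (metis dvd_mult2)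
  then have "P dvd t * (i^2 - B * i * j - j^2) \<longleftrightarrow> P dvd (i - t * j) * (j + t * i)"
    by (metis dvd_add_right_iff diff_add_cancel)
  then show ?thesis using root_not_dvd[OF assms] P_dvd_mult_iff by blast
qed

lemma cong_H_iff:
  assumes "i \<in> H"
  shows "P dvd i - x \<longleftrightarrow> i = x mod P"
  using assms P_eq by (auto simp: mod_eq_dvd_iff[symmetric])

text \<open>Each linear factor gets its own parametrisation: \<open>i = t j\<close> modulo
  \<open>P\<close> has a solution \<open>i\<close> in \<open>H\<close> exactly when
  \<open>t j\<close> has a low residue, and \<open>j = - t i\<close> has a solution \<open>j\<close>
  exactly when \<open>t i\<close> has a high one.\<close>

lemma zeros_eq:
  assumes t: "P dvd t^2 - B * t - 1"
  shows "zeros B = (\<lambda>j. (half_rep t j, j)) ` {j \<in> H. t * j mod P \<le> int n}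
                 \<union> (\<lambda>j. (j, half_rep t j)) ` {j \<in> H. \<not> t * j mod P \<le> int n}"
    (is "_ = ?A \<union> ?C")
proof -
  have nt: "\<not> P dvd t" using root_not_dvd[OF t] .
  have 1: "P dvd i - t * j \<longleftrightarrow> t * j mod P \<le> int n \<and> i = half_rep t j" if "i \<in> H" "j \<in> H" for i j
    using cong_H_iff[OF that(1), of "t * j"] that unfolding half_rep_def by auto
  have 2: "P dvd j + t * i \<longleftrightarrow> \<not> t * i mod P \<le> int n \<and> j = half_rep t i"
    if "i \<in> H" "j \<in> H" for i j
  proof -
    have "\<not> P dvd t * i" using nt that not_dvd_H P_dvd_mult_iff by blast
    then have "(- (t * i)) mod P = P - t * i mod P"
      by (simp add: zmod_zminus1_eq_if mod_eq_0_iff_dvd)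
    then have "P dvd j + t * i \<longleftrightarrow> j = P - t * i mod P"
      using cong_H_iff[OF that(2), of "- (t * i)"] by simp
    then show ?thesis using that P_eq unfolding half_rep_def by auto
  qed
  have "(i, j) \<in> zeros B \<longleftrightarrow> (i, j) \<in> ?A \<union> ?C" for i j
  proof (cases "i \<in> H \<and> j \<in> H")
    case True
    then show ?thesis
      unfolding zeros_def using zeros_factor[OF t, of i j] 1[of i j] 2[of i j] by auto
  next
    case False
    then show ?thesis using half_rep_mem[OF nt] unfolding zeros_def by fastforce
  qed
  then show ?thesis by auto
qed

abbreviation R :: "int set" where "R \<equiv> {0..<P}"

text \<open>\<open>B^2 + 4\<close> is the discriminant of \<open>x^2 - B x - 1\<close>: on
  \<open>X\<close> there are two distinct roots, on \<open>Y\<close> one double root.\<close>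

definition X :: "int set" where
  "X = {B \<in> R. \<not> P dvd B^2 + 4 \<and> QuadRes P (B^2 + 4)}"

definition Y :: "int set" where
  "Y = {B \<in> R. P dvd B^2 + 4}"

lemma QuadRes_iff: "QuadRes P a \<longleftrightarrow> (\<exists>x. P dvd x^2 - a)"
  by (simp add: QuadRes_def cong_iff_dvd_diff)

lemma not_QuadRes_not_dvd: "\<not> QuadRes P a \<Longrightarrow> \<not> P dvd a"
proof
  assume "\<not> QuadRes P a" "P dvd a"
  moreover from this have "P dvd 0 ^ 2 - a" by simp
  ultimately show False using QuadRes_iff by blast
qed

lemma inverse_ex: "\<not> P dvd j \<Longrightarrow> \<exists>k. P dvd j * k - 1"
  using cong_solve_coprime_int[of j P] prime_imp_coprime[OF prime_P, of j]
  by (auto simp: cong_iff_dvd_diff coprime_commute)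

lemma half_rep_low: "t * j mod P \<le> int n \<Longrightarrow> P dvd half_rep t j - t * j"
  by (simp add: half_rep_def mod_eq_dvd_iff[symmetric])

lemma half_rep_high:
  assumes "\<not> t * j mod P \<le> int n"
  shows "P dvd half_rep t j + t * j"
proof -
  have "P dvd t * j - t * j mod P" by (simp add: mod_eq_dvd_iff[symmetric])
  then have "P dvd (t * j - t * j mod P) + P" by simp
  then show ?thesis using assms by (simp add: half_rep_def algebra_simps)
qed

lemma root_ex:
  assumes "QuadRes P (B^2 + 4)"
  shows "\<exists>t. P dvd t^2 - B * t - 1"
proof -
  obtain x where x: "P dvd x^2 - (B^2 + 4)" using assms QuadRes_iff by blast
  \<comment> \<open>The quadratic formula: \<open>int n + 1\<close> is the inverse of 2, since its
    double is \<open>P + 1\<close>.\<close>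
  define t where "t = (B + x) * (int n + 1)"
  have t2: "2 * t = (B + x) * (P + 1)" by (simp add: t_def P_eq)
  have "4 * (t^2 - B * t - 1) = (2 * t)^2 - 2 * B * (2 * t) - 4"
    by (simp add: algebra_simps power2_eq_square)
  also have "\<dots> = P * ((B + x)^2 * (P + 2) - 2 * B * (B + x)) + (x^2 - (B^2 + 4))"
    unfolding t2 by (simp add: algebra_simps power2_eq_square)
  finally have "P dvd 4 * (t^2 - B * t - 1)" using x by (metis dvd_add dvd_triv_left)
  then have "P dvd 2^2 * (t^2 - B * t - 1)" by simp
  then show ?thesis using P_dvd_mult_iff not_dvd_power_2 by blast
qed

text \<open>A nonzero discriminant separates the two roots, so the two families of
  \<open>zeros_eq\<close> are disjoint. Their index sets partition \<open>H\<close>, hence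
  \<open>n\<close> pairs; the coordinates of each pair are some \<open>j\<close> and
  \<open>half_rep t j\<close>, and \<open>half_rep t\<close> permutes \<open>H\<close>.\<close>

lemma
  assumes "P dvd t^2 - B * t - 1" and B: "\<not> P dvd B^2 + 4"
  shows card_zeros_root: "card (zeros B) = n"
    and prod_zeros_root: "(\<Prod>(i, j)\<in>zeros B. i * j) = fact n ^ 2"
proof -
  let ?J = "{j \<in> H. t * j mod P \<le> int n}" and ?K = "{j \<in> H. \<not> t * j mod P \<le> int n}"
  let ?f = "\<lambda>j. (half_rep t j, j)" and ?g = "\<lambda>j. (j, half_rep t j)"
  note t = assms(1)
  have nt: "\<not> P dvd t" using root_not_dvd[OF t] .
  have Z: "zeros B = ?f ` ?J \<union> ?g ` ?K" using zeros_eq[OF t] .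
  have disj: "?f ` ?J \<inter> ?g ` ?K = {}"
  proof (rule ccontr)
    assume "\<not> ?thesis"
    then obtain x where x: "x \<in> ?f ` ?J" "x \<in> ?g ` ?K" by blast
    obtain j where j: "j \<in> ?J" "x = ?f j" using x(1) by (rule imageE)
    obtain i where i: "i \<in> ?K" "x = ?g i" using x(2) by (rule imageE)
    have eq: "?f j = ?g i" using j(2) i(2) by (rule subst)
    have "half_rep t j = i" using arg_cong[OF eq, of fst] by simp
    then have 1: "P dvd i - t * j" using half_rep_low[of t j] j(1) by simp
    have "half_rep t i = j" using arg_cong[OF eq, of snd] by simp
    then have 2: "P dvd j + t * i" using half_rep_high[of t i] i(1) by simp
    \<comment> \<open>A common pair satisfies \<open>i = t j\<close> and \<open>j = - t i\<close>
      modulo \<open>P\<close>, which forces \<open>t^2 = -1\<close>.\<close>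
    have "j * (t^2 + 1) = (j + t * i) - t * (i - t * j)"
      by (simp add: algebra_simps power2_eq_square)
    then have "P dvd j * (t^2 + 1)" using 1 2 by (metis dvd_diff dvd_mult)
    moreover have "\<not> P dvd j" using j(1) not_dvd_H by blast
    ultimately have 3: "P dvd t^2 + 1" using P_dvd_mult_iff by blast
    \<comment> \<open>Modulo \<open>P\<close>, \<open>t^2 = -1\<close> turns the root equation into
      \<open>B t = -2\<close>, and squaring gives \<open>B^2 = -4\<close>; the cofactors record
      this.\<close>
    have "P dvd B^2 + 4"
    proof (rule dvd_combination[OF 3 t])
      show "B^2 + 4 = (B^2 - (t^2 + 1) + 2 * (t^2 - B * t - 1) + 4) * (t^2 + 1)
          + (- (t^2 - B * t - 1) - 4) * (t^2 - B * t - 1)"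
        by (simp add: algebra_simps power2_eq_square)
    qed
    then show False using B by blast
  qed
  have inj: "inj_on ?f ?J" "inj_on ?g ?K" by (auto simp: inj_on_def)
  have JK: "?J \<union> ?K = H" "?J \<inter> ?K = {}" by auto
  have fin: "finite ?J" "finite ?K" by (rule finite_subset[of _ H]; auto)+
  have "card (zeros B) = card ?J + card ?K"
    unfolding Z using disj inj fin by (simp only: card_Un_disjoint card_image finite_imageI)
  also have "\<dots> = card (?J \<union> ?K)" by (rule card_Un_disjoint[symmetric]) (use JK fin in auto)
  finally show "card (zeros B) = n" unfolding JK by simp
  have "(\<Prod>(i, j)\<in>zeros B. i * j) = (\<Prod>j\<in>?J. half_rep t j * j) * (\<Prod>j\<in>?K. half_rep t j * j)"
    unfolding Z using disj inj fin
    by (simp only: prod.union_disjoint prod.reindex finite_imageI) (simp add: mult.commute)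
  also have "\<dots> = (\<Prod>j\<in>?J \<union> ?K. half_rep t j * j)"
    by (rule prod.union_disjoint[symmetric]) (use JK fin in auto)
  also have "\<dots> = (\<Prod>j\<in>H. half_rep t j) * \<Prod>H"
    unfolding JK by (simp add: prod.distrib)
  also have "(\<Prod>j\<in>H. half_rep t j) = \<Prod>H"
    using prod.reindex_bij_betw[OF bij_betw_half_rep[OF nt], of "\<lambda>x. x"] .
  finally show "(\<Prod>(i, j)\<in>zeros B. i * j) = fact n ^ 2"
    by (simp add: prod_atLeastAtMost_int power2_eq_square)
qed

lemma card_zeros_X: "B \<in> X \<Longrightarrow> card (zeros B) = n"
  using root_ex card_zeros_root unfolding X_def by blast

lemma prod_zeros_X: "B \<in> X \<Longrightarrow> (\<Prod>(i, j)\<in>zeros B. i * j) = fact n ^ 2"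
  using root_ex prod_zeros_root unfolding X_def by blast

text \<open>Here \<open>t = B/2\<close> is a double root with \<open>t^2 = -1\<close>, so both
  linear factors vanish on the same pairs. The two families of \<open>zeros_eq\<close> coincide
  while their index sets still partition \<open>H\<close>, so each has \<open>n/2\<close> members;
  in particular \<open>n\<close> is even as soon as \<open>Y\<close> is nonempty.\<close>

lemma card_zeros_Y:
  assumes "B \<in> Y"
  shows "2 * card (zeros B) = n"
proof -
  have B: "P dvd B^2 + 4" using assms unfolding Y_def by blast
  have "P dvd 0^2 - (B^2 + 4)" using B by (metis diff_0 dvd_minus_iff zero_power2)
  then obtain t where t: "P dvd t^2 - B * t - 1" using root_ex QuadRes_iff by blast
  have "(2 * t - B)^2 = 4 * (t^2 - B * t - 1) + (B^2 + 4)"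
    by (simp add: algebra_simps power2_eq_square)
  then have "P dvd (2 * t - B)^2" using t B by (metis dvd_add dvd_mult)
  then have "P dvd 2 * t - B" using P_dvd_power_iff[of 2] by simp
  moreover have "2^2 * (t^2 + 1) = (2 * t + B) * (2 * t - B) + (B^2 + 4)"
    by (simp add: algebra_simps power2_eq_square)
  ultimately have "P dvd 2^2 * (t^2 + 1)" using B by (metis dvd_add dvd_mult)
  then have t1: "P dvd t^2 + 1" using P_dvd_mult_iff not_dvd_power_2 by blast
  let ?J = "{j \<in> H. t * j mod P \<le> int n}" and ?K = "{j \<in> H. \<not> t * j mod P \<le> int n}"
  let ?f = "\<lambda>j. (half_rep t j, j)" and ?g = "\<lambda>j. (j, half_rep t j)"
  have nt: "\<not> P dvd t" using root_not_dvd[OF t] .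
  have swap: "P dvd i - t * j \<longleftrightarrow> P dvd j + t * i" for i j
  proof -
    have "j + t * i = t * (i - t * j) + j * (t^2 + 1)" "i - t * j = i * (t^2 + 1) - t * (j + t * i)"
      by (simp_all add: algebra_simps power2_eq_square)
    then show ?thesis using t1 by (metis dvd_add dvd_diff dvd_mult)
  qed
  have Z: "zeros B = ?f ` ?J \<union> ?g ` ?K" using zeros_eq[OF t] .
  have fJ: "(i, j) \<in> ?f ` ?J \<longleftrightarrow> i \<in> H \<and> j \<in> H \<and> P dvd i - t * j" for i j
    using half_rep_low[of t j] half_rep_mem[OF nt, of j] cong_H_iff[of i "t * j"]
    by (auto simp: half_rep_def)
  have "(i, j) \<in> ?g ` ?K \<Longrightarrow> (i, j) \<in> ?f ` ?J" for i j
    using half_rep_high[of t i] half_rep_mem[OF nt, of i] unfolding fJ swap by auto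
  then have sub1: "?g ` ?K \<subseteq> ?f ` ?J" by auto
  have "(i, j) \<in> ?g ` ?K" if a: "(i, j) \<in> ?f ` ?J" for i j
  proof -
    have ij: "i \<in> H" "j \<in> H" "P dvd i - t * j" using a unfolding fJ by auto
    then have d: "P dvd j + t * i" using swap by blast
    have "\<not> t * i mod P \<le> int n"
    proof
      assume "t * i mod P \<le> int n"
      then have "P dvd half_rep t i - t * i" by (rule half_rep_low)
      then have "P dvd (half_rep t i - t * i) + (j + t * i)" using d by (rule dvd_add)
      then have "P dvd half_rep t i + j" by (simp add: algebra_simps)
      moreover have "half_rep t i \<in> H" using half_rep_mem[OF nt ij(1)] .
      ultimately show False using not_dvd_small[of "half_rep t i + j"] ij(2) P_eq by auto
    qed
    moreover from this have "P dvd (half_rep t i + t * i) - (j + t * i)"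
      using half_rep_high d dvd_diff by blast
    then have "P dvd half_rep t i - j" by simp
    then have "half_rep t i = j mod P" using cong_H_iff[OF half_rep_mem[OF nt ij(1)]] by blast
    then have "half_rep t i = j" using ij(2) P_eq by auto
    ultimately show ?thesis using ij by auto
  qed
  then have sub2: "?f ` ?J \<subseteq> ?g ` ?K" by auto
  have inj: "inj_on ?f ?J" "inj_on ?g ?K" by (auto simp: inj_on_def)
  have "card (zeros B) = card ?J" "card (zeros B) = card ?K"
    using Z sub1 sub2 card_image[OF inj(1)] card_image[OF inj(2)] by (simp_all add: Un_absorb1 Un_absorb2)
  moreover have "card ?J + card ?K = card (?J \<union> ?K)"
    by (rule card_Un_disjoint[symmetric]; (rule finite_subset[of _ H])?) auto
  moreover have "?J \<union> ?K = H" by auto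
  ultimately show ?thesis by simp
qed

text \<open>With \<open>k\<close> inverse to \<open>j\<close>, completing the square in a zero
  \<open>(i, j)\<close> makes \<open>(2 i - B j) k\<close> a square root of
  \<open>B^2 + 4\<close>.\<close>

lemma zeros_empty:
  assumes "B \<in> R" "B \<notin> X" "B \<notin> Y"
  shows "zeros B = {}"
proof (rule ccontr)
  assume "zeros B \<noteq> {}"
  then obtain i j where ij: "i \<in> H" "j \<in> H" "P dvd i^2 - B * i * j - j^2"
    unfolding zeros_def by auto
  obtain k where k: "P dvd j * k - 1" using inverse_ex[OF not_dvd_H[OF ij(2)]] by blast
  have "((2 * i - B * j) * k)^2 - (B^2 + 4) =
      4 * k^2 * (i^2 - B * i * j - j^2) + (B^2 + 4) * (j * k + 1) * (j * k - 1)"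
    by (simp add: algebra_simps power2_eq_square)
  then have "P dvd ((2 * i - B * j) * k)^2 - (B^2 + 4)" using ij(3) k by (metis dvd_add dvd_mult)
  then have "QuadRes P (B^2 + 4)" using QuadRes_iff by blast
  then show False using assms unfolding X_def Y_def by blast
qed

lemma zeros_unique:
  assumes "B \<in> R" "C \<in> R" "x \<in> zeros B" "x \<in> zeros C"
  shows "B = C"
proof -
  obtain i j where x: "x = (i, j)" by force
  have ij: "i \<in> H" "j \<in> H" "P dvd i^2 - B * i * j - j^2" "P dvd i^2 - C * i * j - j^2"
    using assms unfolding x zeros_def by auto
  have "P dvd (i^2 - C * i * j - j^2) - (i^2 - B * i * j - j^2)" using ij by (rule_tac dvd_diff)
  then have "P dvd (B - C) * i * j" by (simp add: algebra_simps)
  then have d: "P dvd B - C" using P_dvd_mult_iff ij not_dvd_H by blast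
  have "\<bar>B - C\<bar> < P" using assms(1,2) by auto
  then show ?thesis using d not_dvd_small[of "B - C"] by auto
qed

lemma zeros_cover: "(\<Union>B\<in>R. zeros B) = H \<times> H"
proof -
  have "\<exists>B\<in>R. (i, j) \<in> zeros B" if ij: "i \<in> H" "j \<in> H" for i j
  proof -
    have "\<not> P dvd i * j" using ij not_dvd_H P_dvd_mult_iff by blast
    then obtain k where k: "P dvd i * j * k - 1" using inverse_ex by blast
    \<comment> \<open>The equation \<open>i^2 - B i j - j^2 = 0\<close> solved for \<open>B\<close>,
      with \<open>k\<close> inverse to \<open>i j\<close>.\<close>
    define C where "C = (i^2 - j^2) * k"
    have "P dvd C - C mod P" by (simp add: mod_eq_dvd_iff[symmetric])
    moreover have "i^2 - (C mod P) * i * j - j^2 = i * j * (C - C mod P) - (i^2 - j^2) * (i * j * k - 1)"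
      by (simp add: C_def algebra_simps)
    ultimately have "P dvd i^2 - (C mod P) * i * j - j^2" using k by (metis dvd_diff dvd_mult)
    then have "(i, j) \<in> zeros (C mod P)" using ij unfolding zeros_def by blast
    moreover have "C mod P \<in> R" using P_pos by simp
    ultimately show ?thesis by blast
  qed
  then have "H \<times> H \<subseteq> (\<Union>B\<in>R. zeros B)" by (simp only: subset_iff) force
  moreover have "(\<Union>B\<in>R. zeros B) \<subseteq> H \<times> H" unfolding zeros_def by blast
  ultimately show ?thesis by (rule equalityI[rotated])
qed

section \<open>Regrouping sums and products over pairs by residue\<close>

lemma sum_card_zeros: "(\<Sum>B\<in>R. card (zeros B)) = n^2"
proof -
  have "card (\<Union>B\<in>R. zeros B) = (\<Sum>B\<in>R. card (zeros B))"
    by (rule card_UN_disjoint) (use finite_zeros zeros_unique in blast)+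
  then show ?thesis unfolding zeros_cover by (simp add: power2_eq_square card_cartesian_product)
qed

lemma X_subset: "X \<subseteq> R" and Y_subset: "Y \<subseteq> R" and XY_disjoint: "X \<inter> Y = {}"
  by (auto simp: X_def Y_def)

lemma finite_X: "finite X" and finite_Y: "finite Y"
  using X_subset Y_subset finite_subset by blast+

lemma card_zeros_0: "B \<in> R - (X \<union> Y) \<Longrightarrow> card (zeros B) = 0"
  using zeros_empty by simp

lemma prod_partition:
  fixes f :: "int \<Rightarrow> 'a::comm_monoid_mult"
  shows "(\<Prod>B\<in>R-{A}. f B ^ card (zeros B)) =
    (\<Prod>B\<in>X-{A}. f B ^ n) * (\<Prod>B\<in>Y-{A}. f B ^ (n div 2))"
proof -
  have "(\<Prod>B\<in>R-{A}. f B ^ card (zeros B)) = (\<Prod>B\<in>(X-{A}) \<union> (Y-{A}). f B ^ card (zeros B))"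
  proof (rule prod.mono_neutral_right)
    show "\<forall>B\<in>R - {A} - (X - {A} \<union> (Y - {A})). f B ^ card (zeros B) = 1"
      using card_zeros_0 by (metis DiffD1 DiffD2 DiffI Un_iff power_0 singletonD)
  qed (use X_subset Y_subset in auto)
  also have "\<dots> = (\<Prod>B\<in>X-{A}. f B ^ card (zeros B)) * (\<Prod>B\<in>Y-{A}. f B ^ card (zeros B))"
    by (rule prod.union_disjoint) (use finite_X finite_Y XY_disjoint in auto)
  also have "(\<Prod>B\<in>X-{A}. f B ^ card (zeros B)) = (\<Prod>B\<in>X-{A}. f B ^ n)"
    using card_zeros_X by (intro prod.cong) auto
  also have "(\<Prod>B\<in>Y-{A}. f B ^ card (zeros B)) = (\<Prod>B\<in>Y-{A}. f B ^ (n div 2))"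
    by (intro prod.cong refl arg_cong[of _ _ "power _"]) (use card_zeros_Y in force)
  finally show ?thesis .
qed

text \<open>Counts the \<open>n^2\<close> pairs by residue. This fixes \<open>card X\<close>, which
  has to agree with the degree of a Lucas polynomial later on.\<close>

lemma card_X_eq: "n * card X + (n div 2) * card Y = n^2"
proof -
  have "(\<Sum>B\<in>R. card (zeros B)) = (\<Sum>B\<in>X \<union> Y. card (zeros B))"
    by (rule sum.mono_neutral_right) (use X_subset Y_subset card_zeros_0 in auto)
  also have "\<dots> = (\<Sum>B\<in>X. card (zeros B)) + (\<Sum>B\<in>Y. card (zeros B))"
    by (rule sum.union_disjoint) (use finite_X finite_Y XY_disjoint in auto)
  also have "(\<Sum>B\<in>X. card (zeros B)) = n * card X" using card_zeros_X by simp
  also have "(\<Sum>B\<in>Y. card (zeros B)) = (\<Sum>B\<in>Y. n div 2)"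
    using card_zeros_Y by (intro sum.cong) force+
  finally show ?thesis using sum_card_zeros by simp
qed

lemma T_eq_prod: "T p 1 (- A) (-1) = (\<Prod>(i, j)\<in>H \<times> H - zeros A. i^2 - A * i * j - j^2)"
proof -
  have n: "(p - 1) div 2 = n" using p_eq by simp
  let ?S = "{(i, j). i \<in> {1..n} \<and> j \<in> {1..n} \<and> \<not> P dvd 1 * int i ^ 2 + - A * int i * int j + -1 * int j ^ 2}"
  have inj: "inj_on (map_prod int int) ?S" by (auto simp: inj_on_def)
  have im: "map_prod int int ` ?S = H \<times> H - zeros A"
  proof (intro equalityI subsetI)
    fix x assume "x \<in> H \<times> H - zeros A"
    then obtain i j where x: "x = (i, j)" "i \<in> H" "j \<in> H" "\<not> P dvd i^2 - A * i * j - j^2"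
      unfolding zeros_def by (cases x) blast
    then have "x = map_prod int int (nat i, nat j)" "(nat i, nat j) \<in> ?S" by auto
    then show "x \<in> map_prod int int ` ?S" by blast
  qed (auto simp: zeros_def)
  show ?thesis unfolding T_def n im[symmetric] prod.reindex[OF inj]
    by (intro prod.cong) auto
qed

text \<open>On \<open>zeros B\<close> the form is \<open>i j (B - A)\<close> modulo
  \<open>P\<close>. The extra factor on the left completes the product of \<open>i j\<close> to all
  of \<open>H \<times> H\<close>, where it is \<open>(n!)^(2 n)\<close>; since \<open>A\<close> is
  not in \<open>Y\<close>, that factor is either empty or given by
  \<open>prod_zeros_X\<close>.\<close>

lemma T_formula:
  assumes A: "A \<in> R" "\<not> P dvd A^2 + 4"
  shows "[T p 1 (- A) (-1) * (\<Prod>(i, j)\<in>zeros A. i * j) =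
     fact n ^ (2 * n) * (\<Prod>B\<in>X-{A}. (B - A) ^ n) * (\<Prod>B\<in>Y. (B - A) ^ (n div 2))] (mod P)"
proof -
  have U: "H \<times> H - zeros A = (\<Union>B\<in>R-{A}. zeros B)"
    using zeros_cover zeros_unique A(1) by blast
  have fin: "finite (R - {A})" "\<forall>B\<in>R-{A}. finite (zeros B)" using finite_zeros by auto
  have dis: "\<forall>B\<in>R-{A}. \<forall>C\<in>R-{A}. B \<noteq> C \<longrightarrow> zeros B \<inter> zeros C = {}" using zeros_unique by blast
  have "T p 1 (- A) (-1) = (\<Prod>B\<in>R-{A}. \<Prod>(i, j)\<in>zeros B. i^2 - A * i * j - j^2)"
    unfolding T_eq_prod U using fin dis by (rule prod.UNION_disjoint)
  also have "[\<dots> = (\<Prod>B\<in>R-{A}. \<Prod>(i, j)\<in>zeros B. (i * j) * (B - A))] (mod P)"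
  proof (intro cong_prod)
    fix B x assume "x \<in> zeros B"
    then obtain i j where x: "x = (i, j)" "P dvd i^2 - B * i * j - j^2"
      unfolding zeros_def by blast
    moreover have "(i^2 - A * i * j - j^2) - (i * j) * (B - A) = i^2 - B * i * j - j^2"
      by (simp add: algebra_simps)
    ultimately show "[case x of (i, j) \<Rightarrow> i^2 - A * i * j - j^2 =
        (case x of (i, j) \<Rightarrow> (i * j) * (B - A))] (mod P)"
      unfolding x case_prod_conv cong_iff_dvd_diff by (simp only:)
  qed
  also have "(\<Prod>B\<in>R-{A}. \<Prod>(i, j)\<in>zeros B. (i * j) * (B - A)) =
      (\<Prod>B\<in>R-{A}. \<Prod>(i, j)\<in>zeros B. i * j) * (\<Prod>B\<in>R-{A}. (B - A) ^ card (zeros B))"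
    by (simp add: prod.distrib split_def)
  also have "(\<Prod>B\<in>R-{A}. (B - A) ^ card (zeros B)) =
      (\<Prod>B\<in>X-{A}. (B - A) ^ n) * (\<Prod>B\<in>Y. (B - A) ^ (n div 2))"
    using prod_partition[of "\<lambda>B. B - A" A] A(2) by (simp add: Y_def)
  also have "(\<Prod>B\<in>R-{A}. \<Prod>(i, j)\<in>zeros B. i * j) = (\<Prod>(i, j)\<in>H \<times> H - zeros A. i * j)"
    unfolding U using fin dis by (rule prod.UNION_disjoint[symmetric])
  finally have "[T p 1 (- A) (-1) * (\<Prod>(i, j)\<in>zeros A. i * j) =
    (\<Prod>(i, j)\<in>H \<times> H - zeros A. i * j) * ((\<Prod>B\<in>X-{A}. (B - A) ^ n) * (\<Prod>B\<in>Y. (B - A) ^ (n div 2)))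
     * (\<Prod>(i, j)\<in>zeros A. i * j)] (mod P)"
    by (rule cong_scalar_right)
  also have "(\<Prod>(i, j)\<in>H \<times> H - zeros A. i * j) * ((\<Prod>B\<in>X-{A}. (B - A) ^ n) * (\<Prod>B\<in>Y. (B - A) ^ (n div 2)))
     * (\<Prod>(i, j)\<in>zeros A. i * j) = ((\<Prod>(i, j)\<in>H \<times> H - zeros A. i * j) * (\<Prod>(i, j)\<in>zeros A. i * j))
     * ((\<Prod>B\<in>X-{A}. (B - A) ^ n) * (\<Prod>B\<in>Y. (B - A) ^ (n div 2)))"
    by (simp only: mult_ac)
  also have "(\<Prod>(i, j)\<in>H \<times> H - zeros A. i * j) * (\<Prod>(i, j)\<in>zeros A. i * j)
      = (\<Prod>(i, j)\<in>H \<times> H. i * j)"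
    by (rule prod.subset_diff[symmetric]) (auto simp: zeros_def)
  also have "(\<Prod>(i, j)\<in>H \<times> H. i * j) = (\<Prod>i\<in>H. \<Prod>j\<in>H. i * j)"
    by (rule prod.cartesian_product[symmetric])
  also have "(\<Prod>i\<in>H. \<Prod>j\<in>H. i * j) = fact n ^ (2 * n)"
    by (simp add: prod.distrib prod_atLeastAtMost_int power_add[symmetric] mult_2 prod_power_distrib[symmetric])
  finally show ?thesis by (simp only: mult.assoc)
qed

end

section \<open>Lucas polynomials and their roots modulo p\<close>

text \<open>The Lucas sequences of \<open>X^2 - x X - 1\<close>, \<open>U\<close> here and
  \<open>V\<close> next. They are polymorphic so that they can be taken at integers, at reals and at
  the polynomial variable \<open>[:0, 1:]\<close>.\<close>

fun lucU :: "'a::comm_ring_1 \<Rightarrow> nat \<Rightarrow> 'a" where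
  "lucU x 0 = 0"
| "lucU x (Suc 0) = 1"
| "lucU x (Suc (Suc k)) = x * lucU x (Suc k) + lucU x k"

fun lucV :: "'a::comm_ring_1 \<Rightarrow> nat \<Rightarrow> 'a" where
  "lucV x 0 = 2"
| "lucV x (Suc 0) = x"
| "lucV x (Suc (Suc k)) = x * lucV x (Suc k) + lucV x k"

lemma poly_lucU: "poly (lucU q k) x = lucU (poly q x) k"
  by (induction k rule: lucU.induct[of _ q]) simp_all

lemma poly_lucV: "poly (lucV q k) x = lucV (poly q x) k"
  by (induction k rule: lucV.induct[of _ q]) simp_all

lemma lucV_Suc: "lucV x (Suc k) = lucU x (Suc (Suc k)) + lucU x k"
proof (induction k rule: induct_nat_012)
  case (ge2 k)
  show ?case
    unfolding lucV.simps(3)[of x "Suc k"] ge2 lucU.simps(3)[of x "Suc (Suc k)"] lucU.simps(3)[of x k]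
    by (simp add: algebra_simps)
qed simp_all

lemma monic_lucU: "degree (lucU [:0, 1:] (Suc k) :: int poly) \<le> k \<and> coeff (lucU [:0, 1:] (Suc k) :: int poly) k = 1"
proof (induction k rule: less_induct)
  case (less k)
  show ?case
  proof (cases k)
    case 0 then show ?thesis by simp
  next
    case (Suc m)
    let ?u = "lucU [:0, 1:] :: nat \<Rightarrow> int poly"
    have eq: "?u (Suc k) = pCons 0 (?u (Suc m)) + ?u m" using Suc by simp
    have 1: "degree (?u (Suc m)) \<le> m" "coeff (?u (Suc m)) m = 1" using less[of m] Suc by auto
    have 2: "degree (?u m) \<le> m"
    proof (cases m)
      case (Suc l)
      then show ?thesis using less[of l] \<open>k = Suc m\<close> by auto
    qed simp
    have "degree (pCons 0 (?u (Suc m))) \<le> k"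
      using 1(1) Suc degree_pCons_le[of 0 "?u (Suc m)"] by linarith
    moreover have "coeff (?u m) k = 0" using 2 Suc by (intro coeff_eq_0) simp
    ultimately show ?thesis unfolding eq using 1 2 Suc by (auto intro: degree_add_le)
  qed
qed

lemma monic_lucV:
  "degree (lucV [:0, 1:] (Suc k) :: int poly) \<le> Suc k \<and> coeff (lucV [:0, 1:] (Suc k) :: int poly) (Suc k) = 1"
proof -
  let ?u = "lucU [:0, 1:] :: nat \<Rightarrow> int poly"
  have 2: "degree (?u k) \<le> k"
  proof (cases k)
    case (Suc l)
    then show ?thesis using monic_lucU[of l] by auto
  qed simp
  have "coeff (?u k) (Suc k) = 0" using 2 by (intro coeff_eq_0) simp
  then show ?thesis unfolding lucV_Suc using 2 monic_lucU[of "Suc k"]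
    by (auto intro!: degree_add_le simp del: lucU.simps)
qed

context odd_prime
begin

section \<open>Euler's criterion and Wilson's theorem\<close>

lemma p_gt_2: "2 < p"
  using p_eq n_pos by simp

lemma half_p_minus_1: "(p - 1) div 2 = n"
  using p_eq by simp

lemma fermat: "\<not> P dvd a \<Longrightarrow> [a ^ (2 * n) = 1] (mod P)"
proof -
  assume a: "\<not> P dvd a"
  have "[Legendre a P = a ^ n] (mod P)"
    using euler_criterion[OF prime_p p_gt_2, of a] half_p_minus_1 by simp
  then have "[Legendre a P ^ 2 = (a ^ n) ^ 2] (mod P)" by (rule cong_pow)
  moreover have "Legendre a P ^ 2 = 1" using a by (simp add: Legendre_def cong_0_iff)
  ultimately show ?thesis by (simp add: power_mult[symmetric] mult.commute cong_sym_eq)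
qed

lemma euler_QuadRes: "QuadRes P a \<Longrightarrow> \<not> P dvd a \<Longrightarrow> [a ^ n = 1] (mod P)"
  using euler_criterion[OF prime_p p_gt_2, of a]
  unfolding half_p_minus_1 by (auto simp: Legendre_def cong_0_iff intro: cong_sym)

lemma euler_nonQuadRes: "\<not> QuadRes P a \<Longrightarrow> [a ^ n = -1] (mod P)"
proof -
  assume a: "\<not> QuadRes P a"
  from not_QuadRes_not_dvd[OF a] show ?thesis using a euler_criterion[OF prime_p p_gt_2, of a]
    unfolding half_p_minus_1 by (auto simp: Legendre_def cong_0_iff intro: cong_sym)
qed

lemma not_cong_1_neg_1: "\<not> [1 = -1] (mod P)"
  using not_dvd_2 by (simp add: cong_iff_dvd_diff)

lemma QuadRes_iff_power: "\<not> P dvd a \<Longrightarrow> QuadRes P a \<longleftrightarrow> [a ^ n = 1] (mod P)"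
  using euler_QuadRes euler_nonQuadRes not_cong_1_neg_1 cong_sym cong_trans by metis

text \<open>Wilson's theorem, with the upper half of \<open>{1..2 n}\<close> folded onto
  \<open>H\<close> by \<open>j \<mapsto> P - j\<close>, which contributes
  \<open>(-1)^n\<close>.\<close>

lemma fact_sq: "[fact n ^ 2 = (-1) ^ (n + 1)] (mod P)"
proof -
  have "{1..int (2 * n)} = H \<union> (\<lambda>j. P - j) ` H"
  proof (intro equalityI subsetI)
    fix x assume x: "x \<in> {1..int (2 * n)}"
    show "x \<in> H \<union> (\<lambda>j. P - j) ` H"
    proof (cases "x \<in> H")
      case False
      then have "P - x \<in> H" "x = P - (P - x)" using x P_eq by auto
      then show ?thesis by blast
    qed simp
  qed (use P_eq in auto)
  then have "\<Prod>{1..int (2 * n)} = \<Prod>H * \<Prod>((\<lambda>j. P - j) ` H)"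
    using P_eq by (simp only:, intro prod.union_disjoint) auto
  also have "\<Prod>((\<lambda>j. P - j) ` H) = (\<Prod>j\<in>H. P - j)"
    by (rule prod.reindex_cong[of "\<lambda>j. P - j"]) (auto simp: inj_on_def)
  finally have "fact (p - 1) = fact n * (\<Prod>j\<in>H. P - j)"
    using p_eq unfolding prod_atLeastAtMost_int by simp
  then have "[fact n * (\<Prod>j\<in>H. P - j) = -1] (mod P)"
    using wilson_theorem[OF prime_p] by simp
  moreover have "[(\<Prod>j\<in>H. P - j) = (\<Prod>j\<in>H. - 1 * j)] (mod P)"
    by (intro cong_prod) (simp add: cong_iff_dvd_diff)
  moreover have "(\<Prod>j\<in>H. - 1 * j) = (- 1) ^ n * fact n"
    unfolding prod.distrib prod_atLeastAtMost_int by simp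
  ultimately have "[fact n * ((- 1) ^ n * fact n) = -1] (mod P)"
    by (metis cong_scalar_left cong_sym cong_trans)
  then have "[(-1) ^ n * (fact n * ((- 1) ^ n * fact n)) = (-1) ^ n * -1] (mod P)"
    by (rule cong_scalar_left)
  moreover have "(-1) ^ n * (fact n * ((- 1) ^ n * fact n)) = (fact n ^ 2 :: int)"
    by (simp add: power2_eq_square flip: power_mult_distrib mult.assoc)
  ultimately show ?thesis by simp
qed

lemma Y_empty: "odd n \<Longrightarrow> Y = {}"
  using card_zeros_Y by (metis dvd_triv_left ex_in_conv)

text \<open>Lagrange's bound on roots modulo \<open>p\<close>, phrased for values instead of
  coefficients. One root is split off at a time by synthetic division, whose remainder
  \<open>poly Q u\<close> is a multiple of \<open>P\<close>.\<close>

lemma poly_dvd_of_roots: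
  fixes Q :: "int poly"
  assumes "S \<subseteq> R" "\<And>u. u \<in> S \<Longrightarrow> P dvd poly Q u" "degree Q < card S"
  shows "P dvd poly Q x"
  using assms
proof (induction "card S" arbitrary: S Q)
  case (Suc m)
  have fin: "finite S" using Suc.hyps(2) by (metis card.infinite nat.distinct(1))
  obtain u where u: "u \<in> S" using Suc.hyps(2) by fastforce
  define C where "C = synthetic_div Q u"
  have Q: "poly Q v = (v - u) * poly C v + poly Q u" for v
  proof -
    have "pCons (poly Q u) C + smult (-u) C + [:0:] = Q + 0"
      using synthetic_div_correct[of Q u] by (simp add: C_def algebra_simps)
    then have "poly (pCons (poly Q u) C + smult (-u) C) v = poly Q v" by simp
    then show ?thesis by (simp add: algebra_simps)
  qed
  have "P dvd poly C x"
  proof (cases "degree Q = 0")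
    case True
    then show ?thesis by (simp add: C_def synthetic_div_eq_0_iff[THEN iffD2])
  next
    case False
    show ?thesis
    proof (rule Suc.hyps(1)[of "S - {u}"])
      show "m = card (S - {u})" using Suc.hyps(2) u fin by simp
      show "S - {u} \<subseteq> R" using Suc.prems(1) by blast
      show "degree C < card (S - {u})"
        using Suc.prems(3) False u fin by (simp add: C_def degree_synthetic_div)
      fix v assume v: "v \<in> S - {u}"
      have "P dvd poly Q v - poly Q u" using Suc.prems(2) u v by (intro dvd_diff) auto
      then have "P dvd (v - u) * poly C v" using Q[of v] by simp
      moreover have "\<not> P dvd v - u"
      proof (rule not_dvd_small)
        have "v \<in> R" "u \<in> R" using v u Suc.prems(1) by blast+
        then show "\<bar>v - u\<bar> < P" by auto
      qed (use v in auto)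
      ultimately show "P dvd poly C v" using P_dvd_mult_iff by blast
    qed
  qed
  then show ?case using Q[of x] Suc.prems(2)[OF u] by simp
qed simp

text \<open>Subtracting the monic product over \<open>S\<close> cancels the leading term, and the
  difference has more roots modulo \<open>p\<close> than its degree allows.\<close>

lemma monic_poly_cong_prod_roots:
  fixes Q :: "int poly"
  assumes S: "S \<subseteq> R" "card S > 0" and roots: "\<And>u. u \<in> S \<Longrightarrow> P dvd poly Q u"
    and Q: "degree Q \<le> card S" "coeff Q (card S) = 1"
  shows "[poly Q x = (\<Prod>u\<in>S. x - u)] (mod P)"
proof -
  define F where "F = (\<Prod>u\<in>S. [:-u, 1:])"
  have fin: "finite S" using S(2) card_gt_0_iff by blast
  have F: "degree F = card S" "lead_coeff F = 1"
    unfolding F_def by (simp add: degree_prod_eq_sum_degree, simp only: lead_coeff_prod, simp)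
  have pF: "poly F v = (\<Prod>u\<in>S. v - u)" for v by (simp add: F_def poly_prod)
  have "degree (Q - F) < card S"
  proof (rule ccontr)
    assume "\<not> ?thesis"
    moreover have "degree (Q - F) \<le> card S" using Q F by (intro degree_diff_le) auto
    ultimately have d: "degree (Q - F) = card S" by simp
    then have "lead_coeff (Q - F) = 0" using Q F by simp
    then have "Q - F = 0" by (simp only: leading_coeff_0_iff)
    then show False using d S(2) by simp
  qed
  moreover have "P dvd poly (Q - F) u" if "u \<in> S" for u
  proof -
    have "poly F u = 0" unfolding pF by (rule prod_zero) (use that fin in auto)
    then show ?thesis using roots[OF that] by simp
  qed
  ultimately have "P dvd poly (Q - F) x" using poly_dvd_of_roots[OF S(1)] by blast
  then show ?thesis by (simp add: cong_iff_dvd_diff pF)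
qed

text \<open>Binet's formula \<open>V_k = t^k + (-1/t)^k\<close>, multiplied by \<open>t^k\<close> to
  stay in the integers.\<close>

lemma lucV_root:
  assumes t: "P dvd t^2 - u * t - 1"
  shows "[t ^ k * lucV u k = t ^ (2 * k) + (-1) ^ k] (mod P)"
proof (induction k rule: induct_nat_012)
  case (ge2 k)
  have ut: "[u * t = t^2 - 1] (mod P)"
    using t dvd_minus_iff[of P "t^2 - u * t - 1"] by (simp add: cong_iff_dvd_diff algebra_simps)
  have "t ^ (Suc (Suc k)) * lucV u (Suc (Suc k)) =
     (u * t) * (t ^ Suc k * lucV u (Suc k)) + t^2 * (t ^ k * lucV u k)"
    by (simp add: algebra_simps power2_eq_square)
  also have "[\<dots> = (t^2 - 1) * (t ^ (2 * Suc k) + (-1) ^ Suc k) + t^2 * (t ^ (2 * k) + (-1) ^ k)] (mod P)"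
    using ge2 ut by (intro cong_add cong_mult[of "u * t"] cong_mult[of "t^2" "t^2"]) (auto simp only: cong_refl)
  also have "(t^2 - 1) * (t ^ (2 * Suc k) + (-1) ^ Suc k) + t^2 * (t ^ (2 * k) + (-1) ^ k)
     = t ^ (2 * Suc (Suc k)) + (-1) ^ Suc (Suc k)"
    by (simp add: algebra_simps power2_eq_square)
  finally show ?case .
qed (use t in \<open>auto simp: cong_iff_dvd_diff algebra_simps power2_eq_square\<close>)

text \<open>Binet's formula \<open>U_k = (t^k - (-1/t)^k) / (t + 1/t)\<close> with denominators
  cleared.\<close>

lemma lucU_root:
  assumes t: "P dvd t^2 - u * t - 1"
  shows "[(t^2 + 1) * (t ^ k * lucU u k) = t * (t ^ (2 * k) - (-1) ^ k)] (mod P)"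
proof (induction k rule: induct_nat_012)
  case (ge2 k)
  have ut: "[u * t = t^2 - 1] (mod P)"
    using t dvd_minus_iff[of P "t^2 - u * t - 1"] by (simp add: cong_iff_dvd_diff algebra_simps)
  have "(t^2 + 1) * (t ^ (Suc (Suc k)) * lucU u (Suc (Suc k))) =
     (u * t) * ((t^2 + 1) * (t ^ Suc k * lucU u (Suc k))) + t^2 * ((t^2 + 1) * (t ^ k * lucU u k))"
    by (simp add: algebra_simps power2_eq_square)
  also have "[\<dots> = (t^2 - 1) * (t * (t ^ (2 * Suc k) - (-1) ^ Suc k)) + t^2 * (t * (t ^ (2 * k) - (-1) ^ k))] (mod P)"
    using ge2 ut by (intro cong_add cong_mult[of "u * t"] cong_mult[of "t^2" "t^2"]) (auto simp only: cong_refl)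
  also have "(t^2 - 1) * (t * (t ^ (2 * Suc k) - (-1) ^ Suc k)) + t^2 * (t * (t ^ (2 * k) - (-1) ^ k))
     = t * (t ^ (2 * Suc (Suc k)) - (-1) ^ Suc (Suc k))"
    by (simp add: algebra_simps power2_eq_square)
  finally show ?case .
qed (use t in \<open>auto simp: cong_iff_dvd_diff algebra_simps power2_eq_square\<close>)

section \<open>The product over \<open>X\<close> as a value of a Lucas polynomial\<close>

lemma card_X_odd: "odd n \<Longrightarrow> card X = n"
  using card_X_eq Y_empty n_pos by (simp add: power2_eq_square)

text \<open>For \<open>u\<close> in \<open>X\<close> with root \<open>t\<close> and odd
  \<open>n\<close>, Binet gives \<open>t^n V_n(u) = t^(2 n) - 1 = 0\<close> modulo \<open>p\<close>.
  As \<open>V_n\<close> is monic of degree \<open>n = card X\<close>, these are all its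
  roots.\<close>

lemma prod_X_odd:
  assumes "odd n"
  shows "[(\<Prod>B\<in>X. A - B) = lucV A n] (mod P)"
proof -
  obtain m where m: "n = Suc m" using n_pos by (cases n) auto
  have "P dvd lucV u n" if u: "u \<in> X" for u
  proof -
    obtain t where t: "P dvd t^2 - u * t - 1" using u root_ex unfolding X_def by blast
    have nt: "\<not> P dvd t" using root_not_dvd[OF t] .
    have "[t ^ n * lucV u n = t ^ (2 * n) + (-1) ^ n] (mod P)" by (rule lucV_root[OF t])
    also have "[t ^ (2 * n) + (-1) ^ n = 1 + (-1) ^ n] (mod P)"
      using fermat[OF nt] by (intro cong_add) auto
    also have "1 + (-1) ^ n = (0::int)" using assms by simp
    finally have "P dvd t ^ n * lucV u n" by (simp add: cong_0_iff)
    then show ?thesis using nt P_dvd_mult_iff P_dvd_power_iff[OF n_pos] by blast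
  qed
  then have "[poly (lucV [:0, 1:] n) A = (\<Prod>u\<in>X. A - u)] (mod P)"
    using X_subset card_X_odd[OF assms] n_pos monic_lucV[of m]
    by (intro monic_poly_cong_prod_roots) (auto simp: poly_lucV m)
  then show ?thesis by (simp add: poly_lucV cong_sym_eq)
qed

lemma Y_even:
  assumes "even n"
  shows "card Y = 2" and "[(\<Prod>B\<in>Y. B - A) = A^2 + 4] (mod P)"
proof -
  \<comment> \<open>For even \<open>n\<close>, \<open>fact_sq\<close> makes \<open>n!\<close> a
    square root of -1, so \<open>c\<close> is a square root of -4.\<close>
  define c where "c = 2 * fact n mod P"
  have cR: "c \<in> R" using P_pos by (simp add: c_def)
  have "[c^2 = (2 * fact n)^2] (mod P)" unfolding c_def by (intro cong_pow) (simp add: cong_def)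
  also have "(2 * fact n)^2 = 4 * (fact n ^ 2 :: int)" by (simp add: power_mult_distrib)
  also have "[4 * fact n ^ 2 = 4 * (-1) ^ (n + 1)] (mod P)" by (intro cong_scalar_left fact_sq)
  also have "4 * (-1) ^ (n + 1) = (-4 :: int)" using assms by simp
  finally have c: "P dvd c^2 + 4" by (simp add: cong_iff_dvd_diff)
  have c0: "c \<noteq> 0" using c not_dvd_power_2[of 2] by auto
  have "B \<in> Y \<longleftrightarrow> B = c \<or> B = P - c" for B
  proof
    assume "B \<in> Y"
    then have B: "B \<in> R" "P dvd B^2 + 4" by (auto simp: Y_def)
    have "P dvd (B^2 + 4) - (c^2 + 4)" using B(2) c by (rule dvd_diff)
    then have "P dvd (B - c) * (B + c)" by (simp add: algebra_simps power2_eq_square)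
    then consider "P dvd B - c" | "P dvd B + c" using P_dvd_mult_iff by blast
    then show "B = c \<or> B = P - c"
    proof cases
      case 1
      have "\<bar>B - c\<bar> < P" using B(1) cR by auto
      then show ?thesis using 1 not_dvd_small[of "B - c"] by auto
    next
      case 2
      then have "P dvd B + c - P" by simp
      moreover have "\<bar>B + c - P\<bar> < P" using B(1) cR c0 by auto
      ultimately show ?thesis using not_dvd_small[of "B + c - P"] by auto
    qed
  next
    have "(P - c)^2 + 4 = P * (P - 2 * c) + (c^2 + 4)" by (simp add: algebra_simps power2_eq_square)
    then have "P dvd (P - c)^2 + 4" using c by (metis dvd_add dvd_triv_left)
    moreover have "P - c \<in> R" using cR c0 by auto
    moreover assume "B = c \<or> B = P - c"
    ultimately show "B \<in> Y" using c cR by (auto simp: Y_def)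
  qed
  then have Y: "Y = {c, P - c}" by blast
  have ne: "c \<noteq> P - c" using P_eq by presburger
  show "card Y = 2" unfolding Y using ne by simp
  have "(\<Prod>B\<in>Y. B - A) - (A^2 + 4) = P * (c - A) - (c^2 + 4)"
    unfolding Y using ne by (simp add: algebra_simps power2_eq_square)
  then show "[(\<Prod>B\<in>Y. B - A) = A^2 + 4] (mod P)"
    unfolding cong_iff_dvd_diff using c by (metis dvd_diff dvd_triv_left)
qed

lemma card_X_even: "even n \<Longrightarrow> card X = n - 1"
proof -
  assume n: "even n"
  have "n * card X + n = n * n"
    using card_X_eq Y_even(1)[OF n] n by (simp add: power2_eq_square)
  then have "n * Suc (card X) = n * n" by simp
  then have "Suc (card X) = n" using n_pos by (simp only: mult_cancel1) simp
  then show ?thesis by simp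
qed

text \<open>The analogue of \<open>prod_X_odd\<close>: for even \<open>n\<close> Binet's numerator
  becomes \<open>t^(2 n) - 1 = 0\<close>, and \<open>U_n\<close> has degree
  \<open>n - 1 = card X\<close>.\<close>

lemma prod_X_even:
  assumes "even n"
  shows "[(\<Prod>B\<in>X. A - B) = lucU A n] (mod P)"
proof -
  obtain m where m: "n = Suc m" using n_pos by (cases n) auto
  \<comment> \<open>An even positive \<open>n\<close> is at least 2, so \<open>X\<close> is
    nonempty, as the factorisation into roots requires.\<close>
  have m0: "m > 0" using m assms by (cases m) auto
  have "P dvd lucU u n" if u: "u \<in> X" for u
  proof -
    obtain t where t: "P dvd t^2 - u * t - 1" using u root_ex unfolding X_def by blast
    have nt: "\<not> P dvd t" using root_not_dvd[OF t] .
    \<comment> \<open>The denominator \<open>t^2 + 1\<close> can be cancelled: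
      \<open>t^2 = -1\<close> would make \<open>t\<close> a double root.\<close>
    have nt1: "\<not> P dvd t^2 + 1"
    proof
      assume "P dvd t^2 + 1"
      from this t have "P dvd u^2 + 4"
      proof (rule dvd_combination)
        show "u^2 + 4 = (u^2 - (t^2 + 1) + 2 * (t^2 - u * t - 1) + 4) * (t^2 + 1)
          + (- (t^2 - u * t - 1) - 4) * (t^2 - u * t - 1)"
          by (simp add: algebra_simps power2_eq_square)
      qed
      then show False using u by (simp add: X_def)
    qed
    have "[(t^2 + 1) * (t ^ n * lucU u n) = t * (t ^ (2 * n) - (-1) ^ n)] (mod P)"
      by (rule lucU_root[OF t])
    also have "[t * (t ^ (2 * n) - (-1) ^ n) = t * (1 - (-1) ^ n)] (mod P)"
      using fermat[OF nt] by (intro cong_scalar_left cong_diff) auto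
    also have "t * (1 - (-1) ^ n) = 0" using assms by simp
    finally have "P dvd (t^2 + 1) * (t ^ n * lucU u n)" by (simp add: cong_0_iff)
    then show ?thesis using nt nt1 P_dvd_mult_iff P_dvd_power_iff[OF n_pos] by blast
  qed
  then have "[poly (lucU [:0, 1:] n) A = (\<Prod>u\<in>X. A - u)] (mod P)"
    using X_subset card_X_even[OF assms] m0 monic_lucU[of m]
    by (intro monic_poly_cong_prod_roots) (auto simp: poly_lucU m)
  then show ?thesis by (simp add: poly_lucU cong_sym_eq)
qed

end

section \<open>Shift operators modulo p\<close>

text \<open>Pascal's rule, read as \<open>(c E + d)^(m+1) = d (c E + d)^m + c E (c E + d)^m\<close>
  for the shift \<open>E\<close> acting on \<open>s\<close>.\<close>

lemma sum_binomial_shift: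
  fixes s :: "nat \<Rightarrow> 'a::comm_ring_1"
  shows "(\<Sum>j\<le>Suc m. of_nat (Suc m choose j) * c ^ j * d ^ (Suc m - j) * s (k + j)) =
    d * (\<Sum>j\<le>m. of_nat (m choose j) * c ^ j * d ^ (m - j) * s (k + j)) +
    c * (\<Sum>j\<le>m. of_nat (m choose j) * c ^ j * d ^ (m - j) * s (Suc k + j))"
proof -
  let ?f = "\<lambda>j. of_nat (m choose j) * c ^ j * d ^ (Suc m - j) * s (k + j)"
  let ?g = "\<lambda>j. of_nat (m choose j) * c ^ Suc j * d ^ (m - j) * s (Suc k + j)"
  have "(\<Sum>j\<le>Suc m. of_nat (Suc m choose j) * c ^ j * d ^ (Suc m - j) * s (k + j)) =
     ?f 0 + (\<Sum>j\<le>m. of_nat (Suc m choose Suc j) * c ^ Suc j * d ^ (m - j) * s (k + Suc j))"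
    by (subst sum.atMost_Suc_shift) simp
  also have "(\<Sum>j\<le>m. of_nat (Suc m choose Suc j) * c ^ Suc j * d ^ (m - j) * s (k + Suc j)) =
      (\<Sum>j\<le>m. ?f (Suc j)) + (\<Sum>j\<le>m. ?g j)"
    by (simp add: sum.distrib[symmetric] algebra_simps)
  also have "?f 0 + ((\<Sum>j\<le>m. ?f (Suc j)) + (\<Sum>j\<le>m. ?g j)) = (\<Sum>j\<le>Suc m. ?f j) + (\<Sum>j\<le>m. ?g j)"
    by (subst sum.atMost_Suc_shift) (simp add: binomial_eq_0)
  also have "(\<Sum>j\<le>Suc m. ?f j) = d * (\<Sum>j\<le>m. of_nat (m choose j) * c ^ j * d ^ (m - j) * s (k + j))"
    by (simp add: sum_distrib_left Suc_diff_le algebra_simps binomial_eq_0)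
  also have "(\<Sum>j\<le>m. ?g j) = c * (\<Sum>j\<le>m. of_nat (m choose j) * c ^ j * d ^ (m - j) * s (Suc k + j))"
    by (simp add: sum_distrib_left algebra_simps)
  finally show ?thesis .
qed

text \<open>The Frobenius congruence with its error term kept explicit, so that it is also
  meaningful over the reals, where the error is \<open>p\<close> times an integer combination of
  values of \<open>f\<close>.\<close>

lemma prime_sum_binomial:
  fixes f :: "nat \<Rightarrow> 'a::comm_ring_1"
  assumes "prime p"
  shows "(\<Sum>j\<le>p. of_nat (p choose j) * f j) =
    f 0 + f p + of_nat p * (\<Sum>j\<in>{0<..<p}. of_nat ((p choose j) div p) * f j)"
proof -
  have p: "p > 0" using assms prime_gt_0_nat by blast
  then have "{..p} = insert 0 (insert p {0<..<p})" by auto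
  then have "(\<Sum>j\<le>p. of_nat (p choose j) * f j) = f 0 + f p + (\<Sum>j\<in>{0<..<p}. of_nat (p choose j) * f j)"
    using p by simp
  also have "(\<Sum>j\<in>{0<..<p}. of_nat (p choose j) * f j) =
      (\<Sum>j\<in>{0<..<p}. of_nat p * (of_nat ((p choose j) div p) * f j))"
  proof (rule sum.cong[OF refl])
    fix j assume "j \<in> {0<..<p}"
    then have "p dvd p choose j" using dvd_choose_prime[of j p] assms by simp
    then have "p choose j = p * ((p choose j) div p)" by simp
    then show "of_nat (p choose j) * f j = of_nat p * (of_nat ((p choose j) div p) * f j)"
      by (metis mult.assoc of_nat_mult)
  qed
  finally show ?thesis by (simp add: sum_distrib_left)
qed

text \<open>The identity \<open>(1 + E)\<^sup>2 = (b + 2) E\<close> for the shift operator \<open>E\<close>, iterated.\<close>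

lemma sum_binomial_unimodular:
  fixes w :: "nat \<Rightarrow> 'a::comm_ring_1"
  assumes w: "\<And>k. w (Suc (Suc k)) = b * w (Suc k) - w k"
  shows "(\<Sum>j\<le>2 * m + 1. of_nat (2 * m + 1 choose j) * w (k + j)) =
    (b + 2) ^ m * (w (k + m) + w (Suc (k + m)))"
proof -
  define S where "S m k = (\<Sum>j\<le>m. of_nat (m choose j) * w (k + j))" for m k
  have S: "S (Suc m) k = S m k + S m (Suc k)" for m k
    using sum_binomial_shift[where c = 1 and d = 1] by (simp add: S_def)
  have even: "S (2 * m) k = (b + 2) ^ m * w (k + m)" for m k
  proof (induction m arbitrary: k)
    case (Suc m)
    have "S (2 * Suc m) k = S (2 * m) k + 2 * S (2 * m) (Suc k) + S (2 * m) (Suc (Suc k))"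
      by (simp add: S algebra_simps)
    also have "\<dots> = (b + 2) ^ m * (w (k + m) + 2 * w (Suc (k + m)) + w (Suc (Suc (k + m))))"
      unfolding Suc by (simp add: algebra_simps)
    also have "w (k + m) + 2 * w (Suc (k + m)) + w (Suc (Suc (k + m))) = (b + 2) * w (Suc (k + m))"
      unfolding w by (simp add: algebra_simps)
    finally show ?case by (simp add: algebra_simps)
  qed (simp add: S_def)
  show ?thesis using S[of "2 * m" k] unfolding even by (simp add: S_def algebra_simps)
qed

text \<open>Likewise \<open>(2 E - A)\<^sup>2 = A\<^sup>2 + 4\<close>, since \<open>E\<^sup>2 = A E + 1\<close> on the Lucas sequence.\<close>

lemma sum_binomial_lucU:
  fixes A :: "'a::comm_ring_1"
  shows "(\<Sum>j\<le>2 * m + 1. of_nat (2 * m + 1 choose j) * 2 ^ j * (- A) ^ (2 * m + 1 - j) * lucU A (k + j)) =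
    (A^2 + 4) ^ m * (2 * lucU A (Suc k) - A * lucU A k)"
proof -
  define S where "S m k = (\<Sum>j\<le>m. of_nat (m choose j) * 2 ^ j * (- A) ^ (m - j) * lucU A (k + j))" for m k
  have S: "S (Suc m) k = - A * S m k + 2 * S m (Suc k)" for m k
    using sum_binomial_shift[where c = 2 and d = "- A"] by (simp add: S_def)
  have even: "S (2 * m) k = (A^2 + 4) ^ m * lucU A k" for m k
  proof (induction m arbitrary: k)
    case (Suc m)
    have "S (2 * Suc m) k = A^2 * S (2 * m) k - 4 * A * S (2 * m) (Suc k) + 4 * S (2 * m) (Suc (Suc k))"
      by (simp add: S algebra_simps power2_eq_square)
    also have "\<dots> = (A^2 + 4) ^ m * (A^2 * lucU A k - 4 * A * lucU A (Suc k) + 4 * lucU A (Suc (Suc k)))"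
      unfolding Suc by (simp add: algebra_simps)
    also have "A^2 * lucU A k - 4 * A * lucU A (Suc k) + 4 * lucU A (Suc (Suc k)) = (A^2 + 4) * lucU A k"
      by (simp add: algebra_simps)
    finally show ?case by (simp add: algebra_simps)
  qed (simp add: S_def)
  show ?thesis using S[of "2 * m" k] unfolding even by (simp add: S_def algebra_simps)
qed

section \<open>The Lucas number at index \<open>n\<close> when \<open>A^2 + 4\<close> is not a
  square\<close>

lemma lucU_double: "lucU x (2 * k + 1) = lucU x (Suc k) ^ 2 + lucU x k ^ 2"
    "lucU x (2 * k) = lucU x k * (2 * lucU x (Suc k) - x * lucU x k)"
proof -
  have add: "lucU x (m + Suc k) = lucU x (Suc m) * lucU x (Suc k) + lucU x m * lucU x k" for m k
  proof (induction m arbitrary: k)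
    case (Suc m)
    have "lucU x (Suc m + Suc k) = lucU x (m + Suc (Suc k))" by (simp only: add_Suc add_Suc_right)
    also have "\<dots> = lucU x (Suc m) * lucU x (Suc (Suc k)) + lucU x m * lucU x (Suc k)" by (rule Suc)
    also have "\<dots> = lucU x (Suc (Suc m)) * lucU x (Suc k) + lucU x (Suc m) * lucU x k"
      by (simp add: algebra_simps)
    finally show ?case .
  qed simp
  show "lucU x (2 * k + 1) = lucU x (Suc k) ^ 2 + lucU x k ^ 2"
    using add[of k k] by (simp add: power2_eq_square mult_2)
  show "lucU x (2 * k) = lucU x k * (2 * lucU x (Suc k) - x * lucU x k)"
  proof (cases k)
    case (Suc m)
    have m: "lucU x m = lucU x (Suc k) - x * lucU x k" unfolding Suc by simp
    have "lucU x (2 * k) = lucU x (k + Suc m)" by (simp only: Suc mult_2)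
    also have "\<dots> = lucU x (Suc k) * lucU x k + lucU x k * lucU x m" unfolding add Suc ..
    also have "\<dots> = lucU x k * (2 * lucU x (Suc k) - x * lucU x k)"
      unfolding m by (simp only: algebra_simps mult_2)
    finally show ?thesis .
  qed simp
qed

lemma lucU_cassini: "lucU x (Suc k) ^ 2 - x * lucU x (Suc k) * lucU x k - lucU x k ^ 2 = (-1) ^ k"
  by (induction k) (simp_all add: algebra_simps power2_eq_square)

context odd_prime
begin

text \<open>Modulo \<open>p\<close>, Frobenius gives \<open>(2 E - A)^p = 2 E^p - A\<close>, while
  \<open>sum_binomial_lucU\<close> gives \<open>(A^2 + 4)^n (2 E - A) = - (2 E - A)\<close>.
  Comparing the two at the indices 0 and 1 of \<open>lucU A\<close> yields the claims.\<close>

lemma lucU_p: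
  assumes D: "[(A^2 + 4) ^ n = -1] (mod P)"
  shows "[lucU A p = -1] (mod P)" and "[lucU A (Suc p) = 0] (mod P)"
proof -
  have key: "[2 * lucU A (k + p) - A * lucU A k = - (2 * lucU A (Suc k) - A * lucU A k)] (mod P)" for k
  proof -
    define r where "r = (\<Sum>j\<in>{0<..<p}. int ((p choose j) div p) * (2 ^ j * (- A) ^ (p - j) * lucU A (k + j)))"
    have "(A^2 + 4) ^ n * (2 * lucU A (Suc k) - A * lucU A k) =
      (\<Sum>j\<le>p. int (p choose j) * (2 ^ j * (- A) ^ (p - j) * lucU A (k + j)))"
      using sum_binomial_lucU[of n A k] by (simp add: p_eq algebra_simps)
    also have "\<dots> = (- A) ^ p * lucU A k + 2 ^ p * lucU A (k + p) + P * r"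
      using prime_sum_binomial[OF prime_p, of "\<lambda>j. 2 ^ j * (- A) ^ (p - j) * lucU A (k + j)"]
      by (simp add: r_def)
    finally have "[(- A) ^ p * lucU A k + 2 ^ p * lucU A (k + p) =
        (A^2 + 4) ^ n * (2 * lucU A (Suc k) - A * lucU A k)] (mod P)"
      by (simp add: cong_iff_dvd_diff)
    moreover have fr: "[a ^ p = a] (mod P)" for a
    proof (cases "P dvd a")
      case True
      then have "P dvd a ^ p" using P_dvd_power_iff[of p a] p_gt_2 by simp
      then show ?thesis using True by (simp add: cong_iff_dvd_diff)
    next
      case False
      have "[a * a ^ (2 * n) = a * 1] (mod P)" using fermat[OF False] by (rule cong_scalar_left)
      then show ?thesis by (simp add: p_eq)
    qed
    have "[(- A) ^ p * lucU A k + 2 ^ p * lucU A (k + p) = - A * lucU A k + 2 * lucU A (k + p)] (mod P)"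
      by (intro cong_add cong_mult fr cong_refl)
    moreover have "[(A^2 + 4) ^ n * (2 * lucU A (Suc k) - A * lucU A k) = -1 * (2 * lucU A (Suc k) - A * lucU A k)] (mod P)"
      by (intro cong_mult D cong_refl)
    ultimately have "[- A * lucU A k + 2 * lucU A (k + p) = -1 * (2 * lucU A (Suc k) - A * lucU A k)] (mod P)"
      by (meson cong_sym cong_trans)
    then show ?thesis by (simp add: algebra_simps)
  qed
  have "P dvd 2 * (lucU A p + 1)" using key[of 0] by (simp add: cong_iff_dvd_diff)
  then have "P dvd lucU A p + 1" using P_dvd_mult_iff not_dvd_2 by blast
  then show "[lucU A p = -1] (mod P)" by (simp add: cong_iff_dvd_diff)
  have "P dvd 2 * lucU A (Suc p)" using key[of 1] by (simp add: cong_iff_dvd_diff)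
  then have "P dvd lucU A (Suc p)" using P_dvd_mult_iff not_dvd_2 by blast
  then show "[lucU A (Suc p) = 0] (mod P)" by (simp only: cong_0_iff)
qed

text \<open>Doubling writes \<open>U_p\<close> and \<open>U_(p+1)\<close> through
  \<open>u = U_n\<close> and \<open>v = U_(n+1)\<close>. Cassini's identity then eliminates
  \<open>v\<close> from the values in \<open>lucU_p\<close> and leaves
  \<open>(A^2 + 4) (u^2 + 1) = 0\<close> modulo \<open>p\<close>.\<close>

lemma lucU_half_sq:
  assumes n: "even n" and D: "\<not> QuadRes P (A^2 + 4)"
  shows "[lucU A n ^ 2 = -1] (mod P)"
proof -
  define u v where "u = lucU A n" and "v = lucU A (Suc n)"
  have D': "[(A^2 + 4) ^ n = -1] (mod P)" using euler_nonQuadRes[OF D] .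
  have "lucU A p = v^2 + u^2" using lucU_double(1)[of A n] by (simp add: p_eq u_def v_def)
  then have 1: "P dvd v^2 + u^2 + 1" using lucU_p(1)[OF D'] by (simp add: cong_iff_dvd_diff)
  have "lucU A (Suc p) = A * lucU A p + lucU A (2 * n)" by (simp add: p_eq)
  then have "lucU A (Suc p) = A * (v^2 + u^2) + u * (2 * v - A * u)"
    using lucU_double(2)[of A n] \<open>lucU A p = v^2 + u^2\<close> by (simp add: u_def v_def)
  then have 2: "P dvd A * (v^2 + u^2) + u * (2 * v - A * u)" using lucU_p(2)[OF D'] by (simp add: cong_0_iff)
  have 3: "v^2 = 1 + A * v * u + u^2"
    using lucU_cassini[of A n] n by (simp add: u_def v_def algebra_simps)
  have "P dvd (A^2 + 4) * (u^2 + 1)"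
  proof (rule dvd_combination[OF 1 2])
    show "(A^2 + 4) * (u^2 + 1) = (A^2 + 2) * (v^2 + u^2 + 1) + (- A) * (A * (v^2 + u^2) + u * (2 * v - A * u))"
      unfolding 3 by (simp add: algebra_simps power2_eq_square)
  qed
  moreover have "\<not> P dvd A^2 + 4" using not_QuadRes_not_dvd[OF D] .
  ultimately have "P dvd u^2 + 1" using P_dvd_mult_iff by blast
  then show ?thesis by (simp add: u_def cong_iff_dvd_diff)
qed

end

section \<open>The value of T for general A\<close>

text \<open>Two-element orbits of \<open>\<tau>\<close> contribute 1 and are removed one at a
  time.\<close>

lemma prod_involution_cong:
  fixes h :: "'a \<Rightarrow> int"
  assumes "finite S"
    and "\<And>x. x \<in> S \<Longrightarrow> \<tau> x \<in> S" and "\<And>x. x \<in> S \<Longrightarrow> \<tau> (\<tau> x) = x"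
    and "\<And>x. x \<in> S \<Longrightarrow> \<tau> x \<noteq> x \<Longrightarrow> [h x * h (\<tau> x) = 1] (mod m)"
  shows "[prod h S = prod h {x \<in> S. \<tau> x = x}] (mod m)"
  using assms
proof (induction "card S" arbitrary: S rule: less_induct)
  case less
  show ?case
  proof (cases "\<forall>x\<in>S. \<tau> x = x")
    case True
    then have "{x \<in> S. \<tau> x = x} = S" by blast
    then show ?thesis by simp
  next
    case False
    then obtain x where x: "x \<in> S" "\<tau> x \<noteq> x" by blast
    define S' where "S' = S - {x, \<tau> x}"
    have S: "S = insert x (insert (\<tau> x) S')" using x less.prems(2) unfolding S'_def by blast
    have fin: "finite S'" using less.prems(1) unfolding S'_def by simp
    have xS': "x \<notin> S'" "\<tau> x \<notin> S'" unfolding S'_def by simp_all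
    have "prod h S = h x * h (\<tau> x) * prod h S'"
      unfolding S using xS' x(2) fin by (simp add: mult.assoc)
    also have "[\<dots> = 1 * prod h {y \<in> S'. \<tau> y = y}] (mod m)"
    proof (intro cong_mult)
      show "[h x * h (\<tau> x) = 1] (mod m)" using less.prems(4) x by blast
      show "[prod h S' = prod h {y \<in> S'. \<tau> y = y}] (mod m)"
      proof (rule less.hyps[OF _ fin])
        show "card S' < card S"
          unfolding S'_def using x less.prems(1) by (intro psubset_card_mono) auto
        fix y assume y: "y \<in> S'"
        then have yS: "y \<in> S" unfolding S'_def by blast
        show "\<tau> (\<tau> y) = y" using less.prems(3) yS by blast
        show "\<tau> y \<noteq> y \<Longrightarrow> [h y * h (\<tau> y) = 1] (mod m)" using less.prems(4) yS by blast
        have "\<tau> y \<noteq> x" "\<tau> y \<noteq> \<tau> x" using less.prems(3)[OF yS] less.prems(3)[OF x(1)] y unfolding S'_def by auto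
        then show "\<tau> y \<in> S'" using less.prems(2)[OF yS] unfolding S'_def by blast
      qed
    qed
    also have "{y \<in> S'. \<tau> y = y} = {y \<in> S. \<tau> y = y}"
      unfolding S'_def using x less.prems(3)[OF x(1)] by auto
    finally show ?thesis by simp
  qed
qed

context odd_prime
begin

section \<open>The product over \<open>X - {A}\<close> when \<open>A^2 + 4\<close> is a nonzero
  square\<close>

lemma R_cong_eq: "B \<in> R \<Longrightarrow> C \<in> R \<Longrightarrow> P dvd B - C \<Longrightarrow> B = C"
proof -
  assume a: "B \<in> R" "C \<in> R" "P dvd B - C"
  then have "\<bar>B - C\<bar> < P" by auto
  then show ?thesis using a(3) not_dvd_small[of "B - C"] by auto
qed

lemma QuadRes_cong: "P dvd a - b \<Longrightarrow> QuadRes P a \<longleftrightarrow> QuadRes P b"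
  unfolding QuadRes_def by (metis cong_iff_dvd_diff cong_sym cong_trans)

text \<open>\<open>B\<close> is paired with \<open>C\<close> when \<open>(B - A) (C - A) = D\<close>
  modulo \<open>P\<close>; the two factors then multiply to \<open>D^n = 1\<close>. The candidates
  for fixed points are \<open>A + d\<close> and \<open>A - d\<close>. Both or neither lie in
  \<open>X\<close>, and if they do they contribute \<open>(d (-d))^n = (-1)^n\<close>.\<close>

lemma prod_X_res:
  assumes A: "A \<in> R" "\<not> P dvd A^2 + 4" and d: "P dvd d^2 - (A^2 + 4)"
  shows "[(\<Prod>B\<in>X-{A}. (B - A) ^ n) = (if QuadRes P (2 * d * (d + A)) then (-1) ^ n else 1)] (mod P)"
proof -
  define D where "D = A^2 + 4"
  have nD: "\<not> P dvd D" and dD: "P dvd d^2 - D" using A d by (simp_all add: D_def)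
  have nd: "\<not> P dvd d"
  proof
    assume "P dvd d"
    then have "P dvd d^2" by (simp add: power2_eq_square)
    then have "P dvd d^2 - (d^2 - D)" using dD by (rule dvd_diff)
    then show False using nD by simp
  qed
  have Dn: "[D ^ n = 1] (mod P)" using euler_QuadRes[of D] QuadRes_iff dD nD by blast
  have dn: "[d ^ (2 * n) = 1] (mod P)" using fermat[OF nd] .
  have nBA: "\<not> P dvd B - A" if "B \<in> X - {A}" for B
    using R_cong_eq[of B A] that X_subset A(1) by blast
  have "\<exists>C. C \<in> R \<and> P dvd (B - A) * (C - A) - D" if B: "B \<in> X - {A}" for B
  proof -
    obtain k where k: "P dvd (B - A) * k - 1" using inverse_ex[OF nBA[OF B]] by blast
    define C where "C = (A + D * k) mod P"
    have C: "P dvd C - (A + D * k)" unfolding C_def by (simp add: mod_eq_dvd_iff[symmetric])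
    have "P dvd (B - A) * (C - A) - D"
      by (rule dvd_combination[OF C k, where a = "B - A" and b = D]) (simp add: algebra_simps)
    then show ?thesis using P_pos by (intro exI[of _ C]) (simp add: C_def)
  qed
  then obtain \<tau> where \<tau>: "\<And>B. B \<in> X - {A} \<Longrightarrow> \<tau> B \<in> R"
      "\<And>B. B \<in> X - {A} \<Longrightarrow> P dvd (B - A) * (\<tau> B - A) - D"
    using bchoice[of "X - {A}" "\<lambda>B C. C \<in> R \<and> P dvd (B - A) * (C - A) - D"] by blast
  have uniq: "\<tau> B = C" if B: "B \<in> X - {A}" and C: "C \<in> R" "P dvd (B - A) * (C - A) - D" for B C
  proof -
    have "P dvd ((B - A) * (\<tau> B - A) - D) - ((B - A) * (C - A) - D)" using \<tau>(2)[OF B] C(2) by (rule dvd_diff)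
    then have "P dvd (B - A) * (\<tau> B - C)" by (simp add: algebra_simps)
    then have "P dvd \<tau> B - C" using nBA[OF B] P_dvd_mult_iff by blast
    then show ?thesis using R_cong_eq \<tau>(1)[OF B] C(1) by blast
  qed
  have \<tau>X: "\<tau> B \<in> X - {A}" if B: "B \<in> X - {A}" for B
  proof -
    define s s' where "s = B - A" and "s' = \<tau> B - A"
    have ss: "P dvd s * s' - D" using \<tau>(2)[OF B] by (simp add: s_def s'_def)
    have ns: "\<not> P dvd s" using nBA[OF B] by (simp add: s_def)
    have nB: "\<not> P dvd B^2 + 4" "QuadRes P (B^2 + 4)" using B by (auto simp: X_def)
    have "\<tau> B \<noteq> A" using ss nD by (auto simp: s'_def)
    \<comment> \<open>By this identity the discriminants of \<open>B\<close> and
      \<open>\<tau> B\<close> differ by the square class of \<open>D\<close>, which is trivial, so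
      \<open>\<tau>\<close> preserves \<open>X\<close>.\<close>
    have "s^2 * (\<tau> B ^ 2 + 4) - D * (B^2 + 4) = (s * s' + D + 2 * A * s) * (s * s' - D)"
      by (simp add: s_def s'_def D_def algebra_simps power2_eq_square)
    then have c: "[s^2 * (\<tau> B ^ 2 + 4) = D * (B^2 + 4)] (mod P)"
      using ss by (simp add: cong_iff_dvd_diff)
    have nt: "\<not> P dvd \<tau> B ^ 2 + 4"
    proof
      assume "P dvd \<tau> B ^ 2 + 4"
      then have "P dvd s^2 * (\<tau> B ^ 2 + 4)" by simp
      then have "P dvd D * (B^2 + 4)" using c cong_dvd_iff cong_sym by (metis cong_0_iff cong_trans)
      then show False using nD nB P_dvd_mult_iff by blast
    qed
    have "[(s^2 * (\<tau> B ^ 2 + 4)) ^ n = (D * (B^2 + 4)) ^ n] (mod P)" using c by (rule cong_pow)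
    moreover have "[(D * (B^2 + 4)) ^ n = 1 * 1] (mod P)"
      unfolding power_mult_distrib using Dn euler_QuadRes[OF nB(2,1)] by (rule cong_mult)
    moreover have "[(s^2 * (\<tau> B ^ 2 + 4)) ^ n = 1 * (\<tau> B ^ 2 + 4) ^ n] (mod P)"
      unfolding power_mult_distrib power_mult[symmetric] using fermat[OF ns] by (rule cong_mult) simp
    ultimately have "[(\<tau> B ^ 2 + 4) ^ n = 1] (mod P)" by (metis cong_sym cong_trans mult_1)
    then have "QuadRes P (\<tau> B ^ 2 + 4)" using QuadRes_iff_power[OF nt] by blast
    then show ?thesis using nt \<open>\<tau> B \<noteq> A\<close> \<tau>(1)[OF B] by (simp add: X_def)
  qed
  have "[(\<Prod>B\<in>X-{A}. (B - A) ^ n) = (\<Prod>B\<in>{B \<in> X-{A}. \<tau> B = B}. (B - A) ^ n)] (mod P)"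
  proof (rule prod_involution_cong)
    fix B assume B: "B \<in> X - {A}"
    show "\<tau> B \<in> X - {A}" using \<tau>X[OF B] .
    show "\<tau> (\<tau> B) = B"
      using uniq[OF \<tau>X[OF B], of B] \<tau>(2)[OF B] B X_subset by (auto simp: mult.commute)
    have "[((B - A) * (\<tau> B - A)) ^ n = D ^ n] (mod P)"
      using \<tau>(2)[OF B] by (intro cong_pow) (simp add: cong_iff_dvd_diff)
    then show "[(B - A) ^ n * (\<tau> B - A) ^ n = 1] (mod P)"
      using Dn cong_trans by (simp add: power_mult_distrib) blast
  qed (use finite_X in simp)
  moreover have "[(\<Prod>B\<in>{B \<in> X-{A}. \<tau> B = B}. (B - A) ^ n) =
      (if QuadRes P (2 * d * (d + A)) then (-1) ^ n else 1)] (mod P)"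
  proof -
    define b c where "b = (A + d) mod P" and "c = (A - d) mod P"
    have bR: "b \<in> R" and cR: "c \<in> R" using P_pos by (simp_all add: b_def c_def)
    have b: "P dvd b - (A + d)" and c: "P dvd c - (A - d)"
      unfolding b_def c_def by (simp_all add: mod_eq_dvd_iff[symmetric])
    have bc: "b \<noteq> c"
    proof
      assume "b = c"
      then have "P dvd (c - (A - d)) - (c - (A + d))" using b c by (simp only: dvd_diff)
      then have "P dvd 2 * d" by (simp add: algebra_simps)
      then show False using nd not_dvd_2 P_dvd_mult_iff by blast
    qed
    have bA: "b \<noteq> A" "c \<noteq> A" using b c nd by auto
    have fixed: "B = b \<or> B = c" if B: "B \<in> X - {A}" "\<tau> B = B" for B
    proof -
      have "P dvd (B - A) * (B - A) - D" using \<tau>(2)[OF B(1)] B(2) by simp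
      then have "P dvd ((B - A) * (B - A) - D) - (d^2 - D)" using dD by (rule dvd_diff)
      then have "P dvd (B - (A + d)) * (B - (A - d))" by (simp add: algebra_simps power2_eq_square)
      then consider "P dvd B - (A + d)" | "P dvd B - (A - d)" using P_dvd_mult_iff by blast
      then show ?thesis
      proof cases
        case 1
        then have "P dvd (B - (A + d)) - (b - (A + d))" using b by (rule dvd_diff)
        then show ?thesis using R_cong_eq[OF _ bR] B(1) X_subset by auto
      next
        case 2
        then have "P dvd (B - (A - d)) - (c - (A - d))" using c by (rule dvd_diff)
        then show ?thesis using R_cong_eq[OF _ cR] B(1) X_subset by auto
      qed
    qed
    have \<tau>b: "\<tau> b = b" if "b \<in> X"
    proof (rule uniq)
      have "P dvd (b - A) * (b - A) - D"
        by (rule dvd_combination[OF b dD, where a = "b - A + d" and b = 1])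
          (simp add: algebra_simps power2_eq_square)
      then show "P dvd (b - A) * (b - A) - D" .
    qed (use that bA bR in auto)
    have \<tau>c: "\<tau> c = c" if "c \<in> X"
    proof (rule uniq)
      have "P dvd (c - A) * (c - A) - D"
        by (rule dvd_combination[OF c dD, where a = "c - A - d" and b = 1])
          (simp add: algebra_simps power2_eq_square)
      then show "P dvd (c - A) * (c - A) - D" .
    qed (use that bA cR in auto)
    \<comment> \<open>\<open>e\<close> and \<open>f\<close> are the discriminants
      \<open>b^2 + 4\<close> and \<open>c^2 + 4\<close> modulo \<open>P\<close>. Their product is
      the nonzero square \<open>(4 d)^2\<close>, so \<open>b\<close> and \<open>c\<close> lie in
      \<open>X\<close> together.\<close>
    define e f where "e = 2 * d * (d + A)" and "f = 2 * d * (d - A)"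
    have "e * f - 16 * d^2 = 4 * d^2 * (d^2 - D)"
      by (simp add: e_def f_def D_def algebra_simps power2_eq_square)
    then have ef: "[e * f = (4 * d)^2] (mod P)" using dD by (simp add: cong_iff_dvd_diff power_mult_distrib)
    have n4d: "\<not> P dvd 4 * d" using nd not_dvd_power_2[of 2] P_dvd_mult_iff by simp
    then have "\<not> P dvd (4 * d)^2" by (subst P_dvd_power_iff) simp_all
    then have "\<not> P dvd e * f" using ef by (metis cong_dvd_iff cong_sym cong_0_iff cong_trans)
    then have ne: "\<not> P dvd e" and nf: "\<not> P dvd f" by auto
    have "[e ^ n * f ^ n = 1] (mod P)"
      using cong_trans[OF cong_pow[OF ef, of n]] fermat[OF n4d]
      by (simp only: power_mult_distrib[symmetric] power_mult[symmetric])
    then have ef': "QuadRes P e \<longleftrightarrow> QuadRes P f"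
      using QuadRes_iff_power[OF ne] QuadRes_iff_power[OF nf]
      by (metis cong_scalar_left cong_scalar_right cong_sym cong_trans mult_1 mult_1_right)
    have be: "P dvd (b^2 + 4) - e"
      by (rule dvd_combination[OF b dD, where a = "b + A + d" and b = "-1"])
        (simp add: D_def e_def algebra_simps power2_eq_square)
    have cf: "P dvd (c^2 + 4) - f"
      by (rule dvd_combination[OF c dD, where a = "c + A - d" and b = "-1"])
        (simp add: D_def f_def algebra_simps power2_eq_square)
    have bX: "b \<in> X \<longleftrightarrow> QuadRes P e"
    proof -
      have "\<not> P dvd b^2 + 4" using be ne by (metis dvd_diffD1 dvd_diff_commute dvd_diffD diff_diff_eq2 add_diff_cancel_left' dvd_diff)
      then show ?thesis using QuadRes_cong[OF be] bR by (simp add: X_def)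
    qed
    have cX: "c \<in> X \<longleftrightarrow> QuadRes P f"
    proof -
      have "\<not> P dvd c^2 + 4" using cf nf by (metis dvd_diffD1 dvd_diff_commute dvd_diffD diff_diff_eq2 add_diff_cancel_left' dvd_diff)
      then show ?thesis using QuadRes_cong[OF cf] cR by (simp add: X_def)
    qed
    show ?thesis
    proof (cases "QuadRes P e")
      case True
      then have "b \<in> X" "c \<in> X" using bX cX ef' by auto
      then have "{B \<in> X-{A}. \<tau> B = B} = {b, c}" using fixed \<tau>b \<tau>c bA by blast
      then have "(\<Prod>B\<in>{B \<in> X-{A}. \<tau> B = B}. (B - A) ^ n) = (b - A) ^ n * (c - A) ^ n" using bc by simp
      also have "[\<dots> = d ^ n * (- d) ^ n] (mod P)"
        using b c by (intro cong_mult cong_pow) (simp_all add: cong_iff_dvd_diff algebra_simps)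
      also have "d ^ n * (- d) ^ n = (-1) ^ n * d ^ (2 * n)"
        by (simp add: power_minus[of d] mult_2 power_add)
      also have "[\<dots> = (-1) ^ n * 1] (mod P)" using dn by (rule cong_scalar_left)
      finally show ?thesis using True by (simp add: e_def)
    next
      case False
      then have "b \<notin> X" "c \<notin> X" using bX cX ef' by auto
      then have "{B \<in> X-{A}. \<tau> B = B} = {}" using fixed by blast
      then show ?thesis using False by (simp only: e_def if_False prod.empty cong_refl)
    qed
  qed
  ultimately show ?thesis by (rule cong_trans)
qed

section \<open>The value of \<open>T\<close> by parity of \<open>n\<close> and character of
  \<open>A^2 + 4\<close>\<close>

lemma fact_power: "[fact n ^ (2 * n) = 1] (mod P)"
proof -
  have "[(fact n ^ 2) ^ n = ((-1) ^ (n + 1)) ^ n] (mod P)" using fact_sq by (rule cong_pow)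
  moreover have "((-1) ^ (n + 1)) ^ n = (1 :: int)"
    unfolding power_mult[symmetric] by (rule neg_one_even_power) simp
  ultimately show ?thesis by (simp add: power_mult)
qed

lemma prod_Y_power:
  "[(\<Prod>B\<in>Y. (B - A) ^ (n div 2)) = (if even n then (A^2 + 4) ^ (n div 2) else 1)] (mod P)"
proof (cases "even n")
  case True
  have "[(\<Prod>B\<in>Y. B - A) ^ (n div 2) = (A^2 + 4) ^ (n div 2)] (mod P)"
    using Y_even(2)[OF True] by (rule cong_pow)
  then show ?thesis using True by (simp add: prod_power_distrib)
qed (simp add: Y_empty)

lemma T_nonres:
  assumes A: "A \<in> R" "\<not> QuadRes P (A^2 + 4)"
  shows "[T p 1 (- A) (-1) = (\<Prod>B\<in>X. B - A) ^ n * (if even n then (A^2 + 4) ^ (n div 2) else 1)] (mod P)"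
proof -
  have nA: "\<not> P dvd A^2 + 4" using not_QuadRes_not_dvd[OF A(2)] .
  have AX: "A \<notin> X" "A \<notin> Y" using A nA by (auto simp: X_def Y_def)
  have "zeros A = {}" using zeros_empty[OF A(1) AX] .
  moreover have "X - {A} = X" using AX by blast
  ultimately have "[T p 1 (- A) (-1) =
     fact n ^ (2 * n) * (\<Prod>B\<in>X. (B - A) ^ n) * (\<Prod>B\<in>Y. (B - A) ^ (n div 2))] (mod P)"
    using T_formula[OF A(1) nA] by simp
  also have "[fact n ^ (2 * n) * (\<Prod>B\<in>X. (B - A) ^ n) * (\<Prod>B\<in>Y. (B - A) ^ (n div 2)) =
      1 * (\<Prod>B\<in>X. (B - A) ^ n) * (if even n then (A^2 + 4) ^ (n div 2) else 1)] (mod P)"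
    by (intro cong_mult fact_power prod_Y_power cong_refl)
  finally show ?thesis by (simp add: prod_power_distrib)
qed

text \<open>Here \<open>A\<close> lies in \<open>X\<close>, so the extra factor in
  \<open>T_formula\<close> is \<open>(n!)^2 = (-1)^(n+1)\<close> modulo \<open>P\<close>, its own
  inverse.\<close>

lemma T_res:
  assumes A: "A \<in> R" "\<not> P dvd A^2 + 4" and d: "P dvd d^2 - (A^2 + 4)"
  shows "[T p 1 (- A) (-1) = (-1) ^ (n + 1) * (if QuadRes P (2 * d * (d + A)) then (-1) ^ n else 1)
     * (if even n then (A^2 + 4) ^ (n div 2) else 1)] (mod P)"
    (is "[?T = _ * ?q * ?r] (mod P)")
proof -
  have "A \<in> X" using A d QuadRes_iff by (auto simp: X_def)
  then have "[?T * fact n ^ 2 = fact n ^ (2 * n) * (\<Prod>B\<in>X-{A}. (B - A) ^ n) * (\<Prod>B\<in>Y. (B - A) ^ (n div 2))] (mod P)"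
    using T_formula[OF A] prod_zeros_X by simp
  also have "[fact n ^ (2 * n) * (\<Prod>B\<in>X-{A}. (B - A) ^ n) * (\<Prod>B\<in>Y. (B - A) ^ (n div 2)) = 1 * ?q * ?r] (mod P)"
    by (intro cong_mult fact_power prod_Y_power prod_X_res[OF A d])
  finally have 1: "[?T * fact n ^ 2 = ?q * ?r] (mod P)" by simp
  have "[?T * fact n ^ 2 = ?T * (-1) ^ (n + 1)] (mod P)" by (intro cong_mult cong_refl fact_sq)
  then have "[?T * (-1) ^ (n + 1) = ?q * ?r] (mod P)" using 1 cong_sym cong_trans by blast
  then have "[(-1) ^ (n + 1) * (?T * (-1) ^ (n + 1)) = (-1) ^ (n + 1) * (?q * ?r)] (mod P)"
    by (rule cong_scalar_left)
  moreover have "(-1) ^ (n + 1) * (?T * (-1) ^ (n + 1)) = ?T"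
    by (simp add: power_mult_distrib[symmetric] flip: mult.assoc)
  ultimately show ?thesis by (simp only: mult.assoc)
qed

lemma T_even_res:
  assumes "even n" "A \<in> R" "\<not> P dvd A^2 + 4" "QuadRes P (A^2 + 4)"
  shows "[T p 1 (- A) (-1) = - ((A^2 + 4) ^ (n div 2))] (mod P)"
proof -
  obtain d where "P dvd d^2 - (A^2 + 4)" using assms(4) QuadRes_iff by blast
  from T_res[OF assms(2,3) this] show ?thesis using assms(1) by (auto split: if_splits)
qed

lemma T_odd_res:
  assumes "odd n" "A \<in> R" "\<not> P dvd A^2 + 4" "P dvd d^2 - (A^2 + 4)"
  shows "[T p 1 (- A) (-1) = (if QuadRes P (2 * d * (d + A)) then -1 else 1)] (mod P)"
  using T_res[OF assms(2-)] assms(1) by (cases "QuadRes P (2 * d * (d + A))") simp_all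

text \<open>For even \<open>n\<close> only the square of \<open>U_n(A)\<close> enters, and
  \<open>lucU_half_sq\<close> gives it as -1.\<close>

lemma T_even_nonres:
  assumes n: "even n" and A: "A \<in> R" "\<not> QuadRes P (A^2 + 4)"
  shows "[T p 1 (- A) (-1) = (-1) ^ (n div 2) * (A^2 + 4) ^ (n div 2)] (mod P)"
proof -
  have "(\<Prod>B\<in>X. B - A) = (\<Prod>B\<in>X. -1 * (A - B))" by simp
  also have "\<dots> = (-1) ^ card X * (\<Prod>B\<in>X. A - B)" unfolding prod.distrib by simp
  finally have "(\<Prod>B\<in>X. B - A) ^ n = ((\<Prod>B\<in>X. A - B) ^ 2) ^ (n div 2)"
    using n by (simp add: power_mult_distrib flip: power_mult)
  also have "[\<dots> = (lucU A n ^ 2) ^ (n div 2)] (mod P)"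
    by (intro cong_pow prod_X_even[OF n])
  also have "[(lucU A n ^ 2) ^ (n div 2) = (-1) ^ (n div 2)] (mod P)"
    by (intro cong_pow lucU_half_sq[OF n A(2)])
  finally have "[(\<Prod>B\<in>X. B - A) ^ n * (A^2 + 4) ^ (n div 2) = (-1) ^ (n div 2) * (A^2 + 4) ^ (n div 2)] (mod P)"
    by (rule cong_scalar_right)
  then show ?thesis using T_nonres[OF A] n cong_trans by simp blast
qed

lemma T_odd_nonres:
  assumes n: "odd n" and A: "A \<in> R" "\<not> QuadRes P (A^2 + 4)"
  shows "[T p 1 (- A) (-1) = - (lucV A n ^ n)] (mod P)"
proof -
  have "(\<Prod>B\<in>X. B - A) = (\<Prod>B\<in>X. -1 * (A - B))" by simp
  also have "\<dots> = (-1) ^ card X * (\<Prod>B\<in>X. A - B)" unfolding prod.distrib by simp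
  also have "\<dots> = - (\<Prod>B\<in>X. A - B)" using n card_X_odd[OF n] by simp
  finally have "(\<Prod>B\<in>X. B - A) ^ n = (- (\<Prod>B\<in>X. A - B)) ^ n" by simp
  also have "[\<dots> = (- lucV A n) ^ n] (mod P)"
    by (intro cong_pow) (use prod_X_odd[OF n] in \<open>simp add: cong_minus_minus_iff\<close>)
  also have "(- lucV A n) ^ n = - (lucV A n ^ n)" using n by simp
  finally have "[(\<Prod>B\<in>X. B - A) ^ n = - (lucV A n ^ n)] (mod P)" .
  then show ?thesis using T_nonres[OF A] n cong_trans by simp blast
qed

end

section \<open>The discriminants 5 and 8\<close>

text \<open>The characteristic polynomial is \<open>X^2 - b X + 1\<close>. For \<open>b\<close>
  equal to \<open>\<surd>2\<close> or the golden ratio its roots are primitive roots of unity of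
  order 8 or 10, whence the antiperiods 4 and 5 below.\<close>

fun recseq :: "'a::comm_ring_1 \<Rightarrow> 'a \<Rightarrow> 'a \<Rightarrow> nat \<Rightarrow> 'a" where
  "recseq b u v 0 = u"
| "recseq b u v (Suc 0) = v"
| "recseq b u v (Suc (Suc k)) = b * recseq b u v (Suc k) - recseq b u v k"

lemma antiperiodic_cong:
  fixes w :: "nat \<Rightarrow> int"
  assumes "\<And>k. [w (k + r) = - w k] (mod m)"
  shows "[w (2 * r * q + j) = w j] (mod m)"
proof (induction q)
  case (Suc q)
  have "[w (2 * r * Suc q + j) = - w (2 * r * q + j + r)] (mod m)"
    using assms[of "2 * r * q + j + r"] by (simp add: algebra_simps)
  also have "[- w (2 * r * q + j + r) = - (- w (2 * r * q + j))] (mod m)"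
    using assms by (simp only: cong_minus_minus_iff)
  finally show ?case using Suc cong_trans by auto
qed simp

lemma antiperiodic:
  fixes w :: "nat \<Rightarrow> 'a::ring_1"
  assumes "\<And>k. w (k + r) = - w k"
  shows "w (2 * r * q + j) = w j"
proof (induction q)
  case (Suc q)
  have "w (2 * r * Suc q + j) = w ((2 * r * q + j + r) + r)" by (simp add: algebra_simps)
  then show ?case using Suc by (simp only: assms minus_minus)
qed simp

section \<open>Coordinates in \<open>Z + Z b\<close> for an irrational \<open>b\<close>\<close>

lemma sqrt_prime_not_Rats:
  assumes "prime (q::nat)"
  shows "sqrt q \<notin> \<rat>"
proof
  assume "sqrt q \<in> \<rat>"
  then obtain m k :: nat where mk: "k \<noteq> 0" "\<bar>sqrt q\<bar> = m / k" "coprime m k" by (rule Rats_abs_nat_div_natE)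
  then have "sqrt q * k = m" by simp
  then have "(sqrt q * k)^2 = m^2" by simp
  then have "real (q * k^2) = real (m^2)" by (simp add: power_mult_distrib)
  then have eq: "q * k^2 = m^2" by (simp only: of_nat_eq_iff)
  then have "q dvd m^2" by (metis dvd_triv_left)
  then have qm: "q dvd m" using assms prime_dvd_power by blast
  then obtain l where "m = q * l" by blast
  then have "k^2 = q * l^2" using eq assms prime_gt_0_nat by (auto simp: power2_eq_square)
  then have "q dvd k^2" by simp
  then have "q dvd k" using assms prime_dvd_power by blast
  then have "q dvd 1" using qm mk(3) coprime_common_divisor by blast
  then show False using assms by simp
qed

text \<open>Turns a real identity between elements of \<open>Z + Z b\<close> into an integer
  identity, by reading off the coefficient of \<open>b\<close>.\<close>

lemma irrational_coord:
  fixes b :: real and x y x' y' :: int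
  assumes b: "b \<notin> \<rat>" and eq: "x + y * b = x' + y' * b"
  shows "y = y'"
proof (rule ccontr)
  assume ne: "y \<noteq> y'"
  then have "b = of_int (x' - x) / of_int (y - y')" using eq by (simp add: field_simps)
  then have "b \<in> \<rat>" by (metis Rats_divide Rats_of_int)
  then show False using b by blast
qed

lemma power_lucU:
  fixes y A :: "'a::comm_ring_1"
  assumes "y^2 = A * y + 1"
  shows "y ^ Suc m = lucU A (Suc m) * y + lucU A m"
proof (induction m)
  case (Suc m)
  have "y ^ Suc (Suc m) = lucU A (Suc m) * y^2 + lucU A m * y"
    unfolding power_Suc[of y "Suc m"] Suc by (simp add: algebra_simps power2_eq_square)
  also have "\<dots> = lucU A (Suc (Suc m)) * y + lucU A (Suc m)"
    unfolding assms by (simp add: algebra_simps)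
  finally show ?case .
qed simp

lemma of_int_lucU: "of_int (lucU x k) = lucU (of_int x) k"
  by (induction k rule: induct_nat_012) simp_all

lemma recseq_coord:
  fixes b :: real
  assumes "\<exists>(x::int) (y::int). b^2 = x + y * b" "\<exists>(x::int) (y::int). u = x + y * b" "\<exists>(x::int) (y::int). v = x + y * b"
  shows "\<exists>(x::int) (y::int). recseq b u v k = x + y * b"
proof (induction k rule: induct_nat_012)
  case (ge2 k)
  obtain x y :: int where 1: "recseq b u v k = x + y * b" using ge2 by blast
  obtain x' y' :: int where 2: "recseq b u v (Suc k) = x' + y' * b" using ge2 by blast
  obtain c d :: int where 3: "b^2 = c + d * b" using assms by blast
  have "recseq b u v (Suc (Suc k)) = y' * b^2 + x' * b - (x + y * b)"
    by (simp add: 1 2 algebra_simps power2_eq_square)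
  also have "\<dots> = of_int (y' * c - x) + of_int (y' * d + x' - y) * b"
    unfolding 3 by (simp add: algebra_simps)
  finally show ?case by blast
qed (use assms in simp_all)

context odd_prime
begin

text \<open>Two evaluations of \<open>(1 + E)^p\<close> at index 0:
  \<open>(b + 2)^n E^n (1 + E)\<close> exactly, and \<open>1 + E^p\<close> modulo
  \<open>p\<close>.\<close>

lemma recseq_int:
  fixes b u v :: int
  defines "w \<equiv> recseq b u v"
  shows "[(b + 2) ^ n * (w n + w (Suc n)) = w 0 + w p] (mod P)"
proof -
  have "(b + 2) ^ n * (w n + w (Suc n)) = (\<Sum>j\<le>p. int (p choose j) * w j)"
    using sum_binomial_unimodular[of w b n 0] by (simp add: w_def p_eq)
  also have "\<dots> = w 0 + w p + P * (\<Sum>j\<in>{0<..<p}. int ((p choose j) div p) * w j)"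
    by (rule prime_sum_binomial[OF prime_p])
  finally show ?thesis by (simp add: cong_iff_dvd_diff)
qed

text \<open>The same over the reals, where congruence modulo \<open>p\<close> in
  \<open>Z + Z b\<close> is expressed by integer coordinates of the error term.\<close>

lemma recseq_real:
  fixes b u v :: real
  defines "w \<equiv> recseq b u v"
  assumes "\<exists>(x::int) (y::int). b^2 = x + y * b" "\<exists>(x::int) (y::int). u = x + y * b" "\<exists>(x::int) (y::int). v = x + y * b"
  shows "\<exists>(x::int) (y::int). (b + 2) ^ n * (w n + w (Suc n)) = w 0 + w p + p * (x + y * b)"
proof -
  obtain f g :: "nat \<Rightarrow> int" where fg: "\<And>k. w k = f k + g k * b"
    using recseq_coord[OF assms(2-)] unfolding w_def by metis
  define h where "h j = int ((p choose j) div p)" for j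
  have "(b + 2) ^ n * (w n + w (Suc n)) = (\<Sum>j\<le>p. of_nat (p choose j) * w j)"
    using sum_binomial_unimodular[of w b n 0] by (simp add: w_def p_eq)
  also have "\<dots> = w 0 + w p + p * (\<Sum>j\<in>{0<..<p}. of_nat ((p choose j) div p) * w j)"
    by (rule prime_sum_binomial[OF prime_p])
  also have "(\<Sum>j\<in>{0<..<p}. of_nat ((p choose j) div p) * w j) =
     of_int (\<Sum>j\<in>{0<..<p}. h j * f j) + of_int (\<Sum>j\<in>{0<..<p}. h j * g j) * b"
    by (simp add: h_def fg sum_distrib_left sum.distrib algebra_simps)
  finally show ?thesis by blast
qed

text \<open>The second supplement to reciprocity, as the case \<open>b = 0\<close>: the sequence is
  1, 0, -1, 0 and so on, \<open>b + 2\<close> is 2, and \<open>w p\<close> vanishes because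
  \<open>p\<close> is odd.\<close>

lemma power_2: "[2 ^ n = (-1) ^ ((n + 1) div 2)] (mod P)"
proof -
  define w :: "nat \<Rightarrow> int" where "w = recseq 0 1 0"
  have w: "w (2 * k) = (-1) ^ k \<and> w (Suc (2 * k)) = 0" for k
    by (induction k) (simp_all add: w_def)
  have "[2 ^ n * (w n + w (Suc n)) = w 0 + w p] (mod P)"
    using recseq_int[of 0 1 0] by (simp add: w_def)
  also have "w 0 + w p = 1" using w[of 0] w[of n] p_eq by simp
  also have "w n + w (Suc n) = (-1) ^ ((n + 1) div 2)"
  proof (cases "even n")
    case True
    then obtain k where "n = 2 * k" by blast
    then show ?thesis using w[of k] by simp
  next
    case False
    then obtain k where "n = 2 * k + 1" by (rule oddE)
    then show ?thesis using w[of k] w[of "Suc k"] by simp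
  qed
  finally have "[2 ^ n * (-1) ^ ((n + 1) div 2) * (-1) ^ ((n + 1) div 2) = 1 * (-1) ^ ((n + 1) div 2)] (mod P)"
    by (rule cong_scalar_right)
  then show ?thesis by (simp add: mult.assoc power_mult_distrib[symmetric])
qed

text \<open>Reciprocity carries no sign here because \<open>(5 - 1) / 2\<close> is even, and the
  nonzero squares modulo 5 are 1 and 4.\<close>

lemma QuadRes_5:
  assumes "p \<noteq> 5"
  shows "QuadRes P 5 \<longleftrightarrow> p mod 5 \<in> {1, 4}"
proof -
  have QR: "Legendre P 5 * Legendre 5 P = 1"
    using Quadratic_Reciprocity[OF prime_p p_gt_2, of 5] assms by (simp add: p_eq)
  then have "\<not> [P = 0] (mod 5)" "\<not> [5 = 0] (mod P)" by (auto simp: Legendre_def)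
  then have "QuadRes P 5 \<longleftrightarrow> QuadRes 5 P" using QR by (auto simp: Legendre_def split: if_splits)
  also have "\<dots> \<longleftrightarrow> P mod 5 \<in> {1, 4}"
  proof
    assume "QuadRes 5 P"
    then obtain y where y: "y^2 mod 5 = P mod 5" by (auto simp: QuadRes_def cong_def)
    have "y^2 mod 5 = (y mod 5)^2 mod 5" by (simp add: power_mod)
    moreover have "y mod 5 \<in> {0, 1, 2, 3, 4}" by auto
    ultimately have "y^2 mod 5 \<in> {0, 1, 4}" by auto
    then show "P mod 5 \<in> {1, 4}" using y \<open>\<not> [P = 0] (mod 5)\<close> by (auto simp: cong_def)
  next
    assume "P mod 5 \<in> {1, 4}"
    then have "[1^2 = P] (mod 5) \<or> [2^2 = P] (mod 5)" by (auto simp: cong_def)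
    then show "QuadRes 5 P" unfolding QuadRes_def by blast
  qed
  also have "\<dots> \<longleftrightarrow> p mod 5 \<in> {1, 4}"
  proof -
    have "P mod 5 = int (p mod 5)" by (simp add: zmod_int)
    then show ?thesis by auto
  qed
  finally show ?thesis .
qed

end

section \<open>Evaluation of \<open>T\<close> for odd \<open>n\<close>\<close>

lemma power_Suc_even: "even m \<Longrightarrow> y ^ Suc m = (y^2) ^ (m div 2) * y" for y :: "'a::comm_ring_1"
  by (simp add: power_mult[symmetric])

text \<open>The factor \<open>b^2 - 2\<close> is kept explicit, so that antiperiodicity follows
  alike for the real \<open>\<surd>2\<close> and for a square root of 2 modulo \<open>p\<close>. The
  factor \<open>b^2 - b - 1\<close> in \<open>recseq_5\<close> does the same for the golden
  ratio.\<close>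

lemma recseq_4:
  "recseq b u v (j + 4) + recseq b u v j = (b * recseq b u v (Suc j) - recseq b u v j) * (b^2 - 2)"
  by (simp add: numeral_eq_Suc algebra_simps)

lemma recseq_5:
  "recseq b u v (j + 5) + recseq b u v j =
    ((b^2 + b - 1) * recseq b u v (Suc j) - (b + 1) * recseq b u v j) * (b^2 - b - 1)"
  by (simp add: numeral_eq_Suc algebra_simps)

context odd_prime
begin

text \<open>Euler's criterion turns the case distinction of \<open>T_odd_res\<close> into a power,
  which \<open>recseq_int\<close> can evaluate.\<close>

lemma T_odd_res_power:
  assumes n: "odd n" and A: "A \<in> R" "\<not> P dvd A^2 + 4" and d: "P dvd d^2 - (A^2 + 4)"
  shows "[T p 1 (- A) (-1) = - ((2 * d * (d + A)) ^ n)] (mod P)"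
proof (cases "QuadRes P (2 * d * (d + A))")
  case True
  have "\<not> P dvd 2 * d * (d + A)"
  proof
    assume "P dvd 2 * d * (d + A)"
    \<comment> \<open>The product with \<open>2 d (d - A)\<close> is \<open>16 (A^2 + 4)\<close>
      modulo \<open>P\<close>, which is a unit.\<close>
    from this d have "P dvd 2 ^ 4 * (A^2 + 4)"
      by (rule dvd_combination[where a = "2 * d * (d - A)" and b = "- 4 * d^2 - 16"])
        (simp add: algebra_simps power2_eq_square)
    then show False using A(2) P_dvd_mult_iff not_dvd_power_2 by blast
  qed
  then have "[(2 * d * (d + A)) ^ n = 1] (mod P)" using euler_QuadRes True by blast
  then have "[- ((2 * d * (d + A)) ^ n) = -1] (mod P)" by (simp only: cong_minus_minus_iff)
  then show ?thesis using T_odd_res[OF n A d] True cong_sym cong_trans by simp blast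
next
  case False
  have "[- ((2 * d * (d + A)) ^ n) = - (-1)] (mod P)"
    using euler_nonQuadRes[OF False] by (simp only: cong_minus_minus_iff)
  then show ?thesis using T_odd_res[OF n A d] False cong_sym cong_trans by simp blast
qed

lemma QuadRes_8: "QuadRes P 8 \<longleftrightarrow> [2 ^ n = 1] (mod P)"
proof -
  have "[(2 ^ n) ^ 2 = 1] (mod P)" using fermat[OF not_dvd_2] by (simp add: power_mult[symmetric] mult.commute)
  then have "[2 ^ n * (2 ^ n)^2 = 2 ^ n * 1] (mod P)" by (rule cong_scalar_left)
  moreover have "(2 * 2^2) ^ n = 2 ^ n * ((2::int) ^ n)^2"
    unfolding power_mult_distrib power_mult[symmetric] by (simp only: mult.commute)
  ultimately have "[8 ^ n = 2 ^ n] (mod P)" by simp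
  moreover have "\<not> P dvd 8" using not_dvd_power_2[of 3] by simp
  ultimately show ?thesis using QuadRes_iff_power cong_trans cong_sym by metis
qed

text \<open>For \<open>b = \<surd>2\<close>, \<open>b + 2 = b (b + 1)\<close>. Since
  \<open>y = b + 1\<close> satisfies \<open>y^2 = 2 y + 1\<close>, its powers have coordinates
  \<open>U_k(2)\<close>, and \<open>b^n = 2^((n-1)/2) b\<close> for odd \<open>n\<close>. The
  coefficient of \<open>b\<close> in the product is \<open>2^((n-1)/2) V_n(2) / 2\<close>.\<close>

lemma lucV_2_cong:
  assumes n: "odd n"
    and w: "\<And>b::real. b^2 = 2 \<Longrightarrow> \<exists>(x::int) (y::int). (b + 2) ^ n = of_int s * (b - 1) + p * (x + y * b)"
  shows "[2 ^ (n div 2) * lucV 2 n = 2 * s] (mod P)"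
proof -
  obtain m where m: "n = Suc m" "even m" using n by (cases n) auto
  define b where "b = sqrt 2"
  have b2: "b^2 = 2" by (simp add: b_def)
  have irr: "b \<notin> \<rat>" using sqrt_prime_not_Rats[of 2] by (simp add: b_def)
  obtain x y :: int where xy: "(b + 2) ^ n = of_int s * (b - 1) + p * (x + y * b)" using w[OF b2] by blast
  have "(b + 1)^2 = 2 * (b + 1) + 1" using b2 by (simp add: power2_eq_square algebra_simps)
  from power_lucU[OF this, of m]
  have u: "(b + 1) ^ n = of_int (lucU 2 n) * (b + 1) + of_int (lucU 2 m)" by (simp only: m of_int_lucU of_int_numeral)
  have "b + 2 = b * (b + 1)" using b2 by (simp add: power2_eq_square algebra_simps)
  then have "(b + 2) ^ n = b ^ n * (b + 1) ^ n" by (simp only: power_mult_distrib)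
  also have "b ^ n = 2 ^ (m div 2) * b" unfolding m power_Suc_even[OF m(2)] b2 ..
  also have "2 ^ (m div 2) * b * (b + 1) ^ n = 2 ^ (m div 2) * (of_int (lucU 2 n) * b^2 + of_int (lucU 2 n + lucU 2 m) * b)"
    unfolding u by (simp add: algebra_simps power2_eq_square)
  finally have "of_int (2 ^ (m div 2) * lucU 2 n * 2) + of_int (2 ^ (m div 2) * (lucU 2 n + lucU 2 m)) * b
      = of_int (P * x - s) + of_int (s + P * y) * b"
    unfolding b2 xy by (simp add: algebra_simps)
  then have "2 ^ (m div 2) * (lucU 2 n + lucU 2 m) = s + P * y" by (rule irrational_coord[OF irr])
  moreover have "lucV (2::int) n = 2 * (lucU 2 n + lucU 2 m)"
    unfolding m lucV_Suc by simp
  ultimately have "2 ^ (m div 2) * lucV 2 n = 2 * s + P * (2 * y)" by (simp add: algebra_simps)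
  moreover have "n div 2 = m div 2" using m by simp
  ultimately show ?thesis by (simp add: cong_iff_dvd_diff)
qed

text \<open>For the golden ratio \<open>b\<close>, \<open>b + 2 = (2 b - 1) b\<close> with
  \<open>2 b - 1 = \<surd>5\<close>. The powers of \<open>b\<close> have Fibonacci coordinates, and
  the coefficient of \<open>b\<close> becomes \<open>5^((n-1)/2)\<close> times the Lucas number
  \<open>V_n(1)\<close>.\<close>

lemma lucV_1_cong:
  assumes n: "odd n"
    and w: "\<And>b::real. b^2 = b + 1 \<Longrightarrow> \<exists>(x::int) (y::int). (b + 2) ^ n = of_int s * (b - 1) + p * (x + y * b)"
  shows "[5 ^ (n div 2) * lucV 1 n = s] (mod P)"
proof -
  obtain m where m: "n = Suc m" "even m" using n by (cases n) auto
  define b :: real where "b = (1 + sqrt 5) / 2"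
  have b2: "b^2 = b + 1" by (simp add: b_def power2_eq_square field_simps)
  have irr: "b \<notin> \<rat>"
  proof
    assume "b \<in> \<rat>"
    then have "2 * b - 1 \<in> \<rat>" by simp
    moreover have "2 * b - 1 = sqrt (real 5)" by (simp add: b_def field_simps)
    ultimately show False using sqrt_prime_not_Rats[of 5] by simp
  qed
  obtain x y :: int where xy: "(b + 2) ^ n = of_int s * (b - 1) + p * (x + y * b)" using w[OF b2] by blast
  have "b^2 = 1 * b + 1" using b2 by simp
  from power_lucU[OF this, of m]
  have u: "b ^ n = of_int (lucU 1 n) * b + of_int (lucU 1 m)" by (simp only: m of_int_lucU of_int_1)
  have e2: "(2 * b - 1)^2 = 5" using b2 by (simp add: power2_eq_square algebra_simps)
  have "b + 2 = (2 * b - 1) * b" using b2 by (simp add: power2_eq_square algebra_simps)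
  then have "(b + 2) ^ n = (2 * b - 1) ^ n * b ^ n" by (simp only: power_mult_distrib)
  also have "(2 * b - 1) ^ n = 5 ^ (m div 2) * (2 * b - 1)"
    unfolding m power_Suc_even[OF m(2)] e2 ..
  also have "5 ^ (m div 2) * (2 * b - 1) * b ^ n =
     5 ^ (m div 2) * (of_int (lucU 1 n) * (2 * b^2 - b) + of_int (lucU 1 m) * (2 * b - 1))"
    unfolding u by (simp add: algebra_simps power2_eq_square)
  finally have "of_int (5 ^ (m div 2) * (2 * lucU 1 n - lucU 1 m)) + of_int (5 ^ (m div 2) * (lucU 1 n + 2 * lucU 1 m)) * b
      = of_int (P * x - s) + of_int (s + P * y) * b"
    unfolding b2 xy by (simp add: algebra_simps)
  then have "5 ^ (m div 2) * (lucU 1 n + 2 * lucU 1 m) = s + P * y" by (rule irrational_coord[OF irr])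
  moreover have "lucV (1::int) n = lucU 1 n + 2 * lucU 1 m"
    unfolding m lucV_Suc by simp
  ultimately have "5 ^ (m div 2) * lucV 1 n = s + P * y" by simp
  moreover have "n div 2 = m div 2" using m by simp
  ultimately show ?thesis by (simp add: cong_iff_dvd_diff)
qed

text \<open>Here 2 is not a square modulo \<open>p\<close>, so \<open>b = \<surd>2\<close> is taken
  in the reals and \<open>T\<close> is reached through \<open>V_n(2)\<close>.\<close>

lemma T_2_mod_8_3:
  assumes "p mod 8 = 3"
  shows "[T p 1 (-2) (-1) = (-1) ^ ((p - 3) div 8)] (mod P)"
proof -
  obtain k where k: "p = 8 * k + 3" using assms by (metis div_mod_decomp mult.commute)
  have n: "n = 4 * k + 1" using k p_eq by simp
  define s :: int where "s = (-1) ^ k"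
  have "[2 ^ n = (-1) ^ ((n + 1) div 2)] (mod P)" by (rule power_2)
  then have two: "[2 ^ n = -1] (mod P)" by (simp add: n)
  then have "\<not> [2 ^ n = 1] (mod P)" using not_cong_1_neg_1 cong_trans cong_sym by blast
  then have nQR: "\<not> QuadRes P (2^2 + 4)" using QuadRes_8 by simp
  have w: "\<exists>(x::int) (y::int). (b + 2) ^ n = of_int s * (b - 1) + p * (x + y * b)" if b: "b^2 = 2" for b :: real
  proof -
    \<comment> \<open>After \<open>b\<close>, 1 the sequence continues 0, -1. For
      \<open>n = 4 k + 1\<close> and \<open>p = 8 k + 3\<close> this makes
      \<open>w n + w (Suc n)\<close> a sign and \<open>w 0 + w p\<close> equal to
      \<open>b - 1\<close>, the shape that \<open>lucV_2_cong\<close> expects.\<close>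
    define w where "w = recseq b b 1"
    have anti4: "w (j + 4) = - w j" for j
      using recseq_4[of b b 1 j] b by (simp add: w_def add_eq_0_iff2)
    have anti: "w (4 * i + j) = (-1) ^ i * w j" for i j
    proof (induction i)
      case (Suc i)
      then show ?case using anti4[of "4 * i + j"] by (simp add: algebra_simps)
    qed simp
    have w3: "w 0 = b" "w (Suc 0) = 1" "w 2 = 0" "w 3 = -1" by (simp_all add: w_def numeral_eq_Suc)
    obtain x y :: int where xy: "(b + 2) ^ n * (w n + w (Suc n)) = w 0 + w p + p * (x + y * b)"
    proof -
      have "\<exists>(x::int) (y::int). b^2 = x + y * b" by (intro exI[of _ 2] exI[of _ 0]) (simp add: b)
      moreover have "\<exists>(x::int) (y::int). b = x + y * b" by (intro exI[of _ 0] exI[of _ 1]) simp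
      moreover have "\<exists>(x::int) (y::int). 1 = x + y * b" by (intro exI[of _ 1] exI[of _ 0]) simp
      ultimately show ?thesis using recseq_real[of b b 1] that unfolding w_def by blast
    qed
    have "w n = (-1) ^ k" using anti[of k 1] by (simp add: n w3)
    moreover have "w (Suc n) = 0" using anti[of k 2] by (simp add: n w3)
    moreover have "w p = -1" using anti[of "2 * k" 3] by (simp add: k w3)
    ultimately have "(b + 2) ^ n * (-1) ^ k = b - 1 + p * (x + y * b)" using xy w3 by simp
    then have "(-1) ^ k * ((b + 2) ^ n * (-1) ^ k) = (-1) ^ k * (b - 1 + p * (x + y * b))" by simp
    then have "(b + 2) ^ n = of_int s * (b - 1) + p * (of_int (s * x) + of_int (s * y) * b)"
      by (simp add: s_def algebra_simps flip: power_mult_distrib)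
    then show ?thesis by blast
  qed
  have odd: "odd n" by (simp add: n)
  have "[2 ^ (n div 2) * lucV 2 n = 2 * s] (mod P)" by (rule lucV_2_cong[OF odd w])
  \<comment> \<open>The power \<open>n\<close> turns each 2 into the character
    \<open>2^n = -1\<close>. As \<open>n div 2 = 2 k\<close> is even and an odd power fixes the sign
    \<open>s\<close>, this leaves \<open>lucV 2 n ^ n = - s\<close> modulo \<open>P\<close>.\<close>
  then have "[(2 ^ (n div 2) * lucV 2 n) ^ n = (2 * s) ^ n] (mod P)" by (rule cong_pow)
  moreover have "(2 ^ (n div 2) * lucV (2::int) n) ^ n = (2 ^ n) ^ (n div 2) * lucV 2 n ^ n"
    unfolding power_mult_distrib by (simp only: mult.commute flip: power_mult)
  moreover have "[(2 ^ n) ^ (n div 2) * lucV 2 n ^ n = (-1) ^ (n div 2) * lucV 2 n ^ n] (mod P)"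
    by (intro cong_mult cong_pow two cong_refl)
  moreover have "[(2 * s) ^ n = -1 * s ^ n] (mod P)"
    unfolding power_mult_distrib by (intro cong_mult two cong_refl)
  ultimately have "[(-1) ^ (n div 2) * lucV 2 n ^ n = -1 * s ^ n] (mod P)" by (metis cong_sym cong_trans)
  moreover have "(-1) ^ (n div 2) = (1::int)" by (simp add: n)
  moreover have "s ^ n = s" unfolding s_def n by (cases "even k") simp_all
  ultimately have "[lucV 2 n ^ n = - s] (mod P)" by simp
  then have "[- (lucV 2 n ^ n) = - (- s)] (mod P)" by (simp only: cong_minus_minus_iff)
  moreover have "[T p 1 (- 2) (-1) = - (lucV 2 n ^ n)] (mod P)"
    using T_odd_nonres[OF odd _ nQR] p_gt_2 by simp
  ultimately show ?thesis using cong_trans by (simp add: s_def k) blast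
qed

text \<open>Now 2 is a square modulo \<open>p\<close>, so \<open>b\<close> can be an integer with
  \<open>b^2 = 2\<close> modulo \<open>p\<close>, and \<open>d = 2 b\<close> is a square root of the
  discriminant 8.\<close>

lemma T_2_mod_8_7:
  assumes "p mod 8 = 7"
  shows "[T p 1 (-2) (-1) = (-1) ^ ((p - 7) div 8)] (mod P)"
proof -
  obtain k where k: "p = 8 * k + 7" using assms by (metis div_mod_decomp mult.commute)
  have n: "n = 4 * k + 3" using k p_eq by simp
  have two: "[2 ^ n = 1] (mod P)" using power_2 by (simp add: n)
  then have "QuadRes P 2" using QuadRes_iff_power[OF not_dvd_2] by blast
  then obtain b where b: "P dvd b^2 - 2" using QuadRes_iff by blast
  \<comment> \<open>The terms start 0, 1, \<open>b\<close>, 1 modulo \<open>P\<close>; so at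
    \<open>n = 4 k + 3\<close> and at \<open>p = 4 (2 k + 1) + 3\<close> they are signs, while
    \<open>w (Suc n)\<close> and \<open>w 0\<close> vanish.\<close>
  define w where "w = recseq b 0 1"
  have anti4: "[w (j + 4) = - w j] (mod P)" for j
  proof -
    have "P dvd w (j + 4) + w j" unfolding w_def recseq_4 using b by (rule dvd_mult)
    then show ?thesis by (simp add: cong_iff_dvd_diff)
  qed
  have anti: "[w (4 * i + j) = (-1) ^ i * w j] (mod P)" for i j
  proof (induction i)
    case (Suc i)
    have "[w (4 * Suc i + j) = - w (4 * i + j)] (mod P)" using anti4[of "4 * i + j"] by (simp add: algebra_simps)
    also have "[- w (4 * i + j) = - ((-1) ^ i * w j)] (mod P)" using Suc by (simp only: cong_minus_minus_iff)
    finally show ?case by simp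
  qed simp
  have w3: "w 0 = 0" "[w 3 = 1] (mod P)"
    using b by (simp_all add: w_def numeral_eq_Suc cong_iff_dvd_diff power2_eq_square)
  have "[w n = (-1) ^ k * 1] (mod P)"
    using anti[of k 3] cong_scalar_left[OF w3(2)] cong_trans unfolding n by blast
  moreover have "[w (Suc n) = 0] (mod P)" using anti[of "Suc k" 0] w3 by (simp add: n algebra_simps)
  ultimately have wn: "[w n + w (Suc n) = (-1) ^ k * 1 + 0] (mod P)" by (rule cong_add)
  have pe: "p = 4 * (2 * k + 1) + 3" by (simp add: k)
  have "[w (4 * (2 * k + 1) + 3) = (-1) ^ (2 * k + 1) * 1] (mod P)"
    using cong_trans[OF anti cong_scalar_left[OF w3(2)]] .
  then have "[w p = (-1) ^ (2 * k + 1) * 1] (mod P)" unfolding pe[symmetric] .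
  then have "[w 0 + w p = -1] (mod P)" by (simp add: w3)
  moreover have "[(b + 2) ^ n * (w n + w (Suc n)) = w 0 + w p] (mod P)" using recseq_int unfolding w_def .
  ultimately have "[(b + 2) ^ n * ((-1) ^ k * 1 + 0) = -1] (mod P)"
    using cong_scalar_left[OF wn, of "(b + 2) ^ n"] cong_sym cong_trans by blast
  then have "[(b + 2) ^ n * (-1) ^ k = -1] (mod P)" by simp
  then have "[(b + 2) ^ n * (-1) ^ k * (-1) ^ k = -1 * (-1) ^ k] (mod P)" by (rule cong_scalar_right)
  then have bn: "[(b + 2) ^ n = - ((-1) ^ k)] (mod P)" by (simp add: mult.assoc flip: power_mult_distrib)
  define e where "e = 2 * (2 * b) * (2 * b + 2)"
  have "e - 8 * (b + 2) = 8 * (b^2 - 2)" by (simp add: e_def algebra_simps power2_eq_square)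
  then have "P dvd e - 8 * (b + 2)" using b by (metis dvd_mult)
  then have "[e = 2^3 * (b + 2)] (mod P)" by (simp add: cong_iff_dvd_diff)
  then have "[e ^ n = (2^3 * (b + 2)) ^ n] (mod P)" by (rule cong_pow)
  also have "(2^3 * (b + 2)) ^ n = (2 ^ n) ^ 3 * (b + 2) ^ n"
    unfolding power_mult_distrib by (simp only: mult.commute flip: power_mult)
  also have "[\<dots> = 1 ^ 3 * - ((-1) ^ k)] (mod P)" by (intro cong_mult cong_pow two bn)
  finally have en: "[e ^ n = - ((-1) ^ k)] (mod P)" by simp
  have "(2 * b)^2 - (2^2 + 4) = 4 * (b^2 - 2)" by simp
  then have "P dvd (2 * b)^2 - (2^2 + 4)" using b by (metis dvd_mult)
  moreover have "\<not> P dvd 2^2 + 4" using not_dvd_power_2[of 3] by simp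
  moreover have "odd n" by (simp add: n)
  ultimately have "[T p 1 (- 2) (-1) = - (e ^ n)] (mod P)"
    using T_odd_res_power[of 2 "2 * b"] p_gt_2 by (simp add: e_def)
  also have "[- (e ^ n) = - (- ((-1) ^ k))] (mod P)" using en by (simp only: cong_minus_minus_iff)
  finally show ?thesis by (simp add: k)
qed

lemma T_1_res:
  assumes n: "odd n" and p5: "p mod 5 \<in> {1, 4}"
  shows "[T p 1 (-1) (-1) = (if p mod 5 = 1 then 1 else -1)] (mod P)"
proof -
  have "p \<noteq> 5" using p5 by auto
  then have "QuadRes P 5" using QuadRes_5 p5 by blast
  then obtain d where d: "P dvd d^2 - 5" using QuadRes_iff by blast
  \<comment> \<open>The golden ratio modulo \<open>P\<close>, with \<open>d\<close> as square root
    of 5 and \<open>int n + 1\<close> as inverse of 2.\<close>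
  define b where "b = (1 + d) * (int n + 1)"
  have b2: "2 * b = (1 + d) * (P + 1)" by (simp add: b_def P_eq)
  have "2^2 * (b^2 - b - 1) = (2 * b - 1)^2 - 5" by (simp add: algebra_simps power2_eq_square)
  also have "\<dots> = P * ((1 + d) * (2 * d + P * (1 + d))) + (d^2 - 5)"
    unfolding b2 by (simp add: algebra_simps power2_eq_square)
  finally have "P dvd 2^2 * (b^2 - b - 1)" using d by (metis dvd_add dvd_triv_left)
  then have b: "P dvd b^2 - b - 1" using P_dvd_mult_iff not_dvd_power_2 by blast
  \<comment> \<open>Half a period is 0, 1, \<open>b\<close>, \<open>b\<close>, 1 modulo
    \<open>P\<close>.\<close>
  define w where "w = recseq b 0 1"
  have anti5: "[w (j + 5) = - w j] (mod P)" for j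
  proof -
    have "P dvd w (j + 5) + w j" unfolding w_def recseq_5 using b by (rule dvd_mult)
    then show ?thesis by (simp add: cong_iff_dvd_diff)
  qed
  have anti: "[w (10 * i + j) = w j] (mod P)" for i j using antiperiodic_cong[of w 5, OF anti5, of i j] by simp
  have w4: "[w 4 = 1] (mod P)"
  proof -
    have "w 4 - 1 = (b + 1) * (b^2 - b - 1)" by (simp add: w_def numeral_eq_Suc algebra_simps)
    then show ?thesis using b by (simp add: cong_iff_dvd_diff)
  qed
  have key: "[(b + 2) ^ n * (w n + w (Suc n)) = w 0 + w p] (mod P)" using recseq_int unfolding w_def .
  define t :: int where "t = (if p mod 5 = 1 then 1 else -1)"
  have "[w n + w (Suc n) = -1] (mod P) \<and> [w p = t] (mod P)"
  proof (cases "p mod 5 = 1")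
    case True
    define i where "i = n div 10"
    \<comment> \<open>From \<open>p = 2 n + 1\<close> and \<open>p mod 5 = 1\<close>,
      \<open>n\<close> is a multiple of 5, and it is odd; the other class gives 9 modulo 10 in the
      same way.\<close>
    have i: "n = 10 * i + 5" using True n p_eq unfolding i_def by presburger
    have "[w n = - w 0] (mod P)"
      unfolding i using cong_trans[OF anti anti5[of 0]] by simp
    moreover have "[w (Suc n) = - w 1] (mod P)"
      using cong_trans[OF anti[of i 6]] anti5[of 1] by (simp add: i add.commute)
    ultimately have "[w n + w (Suc n) = - w 0 + - w 1] (mod P)" by (rule cong_add)
    moreover have "p = 10 * (2 * i + 1) + 1" using i p_eq by simp
    then have "[w p = w 1] (mod P)" using anti[of "2 * i + 1" 1] by metis
    ultimately show ?thesis using True by (simp add: w_def t_def)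
  next
    case False
    then have p4: "p mod 5 = 4" using p5 by blast
    define i where "i = n div 10"
    have i: "n = 10 * i + 9" using p4 n p_eq unfolding i_def by presburger
    have "[- w 4 = -1] (mod P)" using w4 by (simp only: cong_minus_minus_iff)
    then have w9: "[w 9 = -1] (mod P)" using cong_trans[OF anti5[of 4]] by simp
    have "[w n = -1] (mod P)" unfolding i by (rule cong_trans[OF anti w9])
    moreover have "[w (Suc n) = w 0] (mod P)" using anti[of "Suc i" 0] by (simp add: i)
    ultimately have "[w n + w (Suc n) = -1 + w 0] (mod P)" by (rule cong_add)
    moreover have "p = 10 * (2 * i + 1) + 9" using i p_eq by simp
    then have "[w p = -1] (mod P)" using cong_trans[OF anti[of "2 * i + 1" 9] w9] by metis
    ultimately show ?thesis using False by (simp add: w_def t_def)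
  qed
  then have wn: "[w n + w (Suc n) = -1] (mod P)" and "[w 0 + w p = t] (mod P)" by (simp_all add: w_def)
  then have "[(b + 2) ^ n * -1 = t] (mod P)"
    using key cong_scalar_left[OF wn, of "(b + 2) ^ n"] cong_sym cong_trans by blast
  then have "[- ((b + 2) ^ n * -1) = - t] (mod P)" by (simp only: cong_minus_minus_iff)
  then have bn: "[(b + 2) ^ n = - t] (mod P)" by simp
  \<comment> \<open>With \<open>2 b = 1 + d\<close> and \<open>d^2 = 5\<close>, both terms are
    \<open>2 d + 10\<close> modulo \<open>P\<close>.\<close>
  have "2 * d * (d + 1) - 2^2 * (b + 2) = 2 * d * (d + 1) - 2 * (2 * b) - 8" by simp
  also have "\<dots> = 2 * (d^2 - 5) + (- 2 * (1 + d)) * P"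
    unfolding b2 by (simp add: algebra_simps power2_eq_square)
  finally have "P dvd 2 * d * (d + 1) - 2^2 * (b + 2)" by (rule dvd_combination[OF d dvd_refl])
  then have "[(2 * d * (d + 1)) ^ n = (2^2 * (b + 2)) ^ n] (mod P)"
    by (intro cong_pow) (simp only: cong_iff_dvd_diff)
  also have "(2^2 * (b + 2)) ^ n = 2 ^ (2 * n) * (b + 2) ^ n"
    by (simp only: power_mult_distrib power_mult)
  also have "[\<dots> = 1 * - t] (mod P)" by (intro cong_mult fermat not_dvd_2 bn)
  finally have "[- ((2 * d * (d + 1)) ^ n) = - (1 * - t)] (mod P)" by (simp only: cong_minus_minus_iff)
  then have en: "[- ((2 * d * (d + 1)) ^ n) = t] (mod P)" by simp
  have "[T p 1 (- 1) (-1) = - ((2 * d * (d + 1)) ^ n)] (mod P)"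
    using T_odd_res_power[OF n, of 1 d] d p_gt_2 not_dvd_5[OF \<open>p \<noteq> 5\<close>] by simp
  then show ?thesis using en cong_trans unfolding t_def by blast
qed

text \<open>5 is not a square modulo \<open>p\<close>, so the golden ratio is taken in the reals and
  \<open>T\<close> is reached through the Lucas number \<open>V_n(1)\<close>.\<close>

lemma T_1_nonres:
  assumes "p mod 20 \<in> {3, 7}"
  shows "[T p 1 (-1) (-1) = (-1) ^ (p div 20 + 1)] (mod P)"
proof -
  define k where "k = p div 20"
  define s :: int where "s = (if p mod 20 = 3 then 1 else -1)"
  have n: "n = 10 * k + (if p mod 20 = 3 then 1 else 3)"
    using assms p_eq unfolding k_def by (auto split: if_splits; presburger)
  then have odd: "odd n" by auto
  have "p mod 5 \<notin> {1, 4}" "p \<noteq> 5" using assms mod_mod_cancel[of 5 20 p] by auto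
  then have nQR: "\<not> QuadRes P (1^2 + 4)" using QuadRes_5 by simp
  have five: "[5 ^ n = -1] (mod P)" using euler_nonQuadRes[OF nQR] by simp
  have w: "\<exists>(x::int) (y::int). (b + 2) ^ n = of_int s * (b - 1) + p * (x + y * b)"
    if b: "b^2 = b + 1" for b :: real
  proof -
    have anti5: "recseq b u v (j + 5) = - recseq b u v j" for u v j
      using recseq_5[of b u v j] b by (simp add: add_eq_0_iff2)
    have anti: "recseq b u v (10 * i + j) = recseq b u v j" for u v i j
      using antiperiodic[of "recseq b u v" 5 i j] anti5 by simp
    have bb: "b * b = b + 1" using b by (simp add: power2_eq_square)
    have ex: "\<exists>(x::int) (y::int). b^2 = x + y * b" "\<exists>(x::int) (y::int). b = x + y * b"
        "\<exists>(x::int) (y::int). 1 = x + y * b"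
      by (intro exI[of _ 1] exI[of _ 1], simp add: b)
        (intro exI[of _ 0] exI[of _ 1], simp, intro exI[of _ 1] exI[of _ 0], simp)
    show ?thesis
    proof (cases "p mod 20 = 3")
      case True
      \<comment> \<open>The terms \<open>b\<close>, 1, 0, -1 give \<open>w 1 + w 2 = 1\<close> and
        \<open>w 0 + w 3 = b - 1\<close>.\<close>
      define w where "w = recseq b b 1"
      have "n = 10 * k + 1" "Suc n = 10 * k + 2" "p = 10 * (2 * k) + 3" using n True p_eq by simp_all
      then have "w n = w 1" "w (Suc n) = w 2" "w p = w 3" unfolding w_def using anti by metis+
      then have "w n + w (Suc n) = 1" "w 0 + w p = b - 1" by (simp_all add: w_def numeral_eq_Suc)
      then show ?thesis using recseq_real[OF ex] True by (simp add: w_def s_def)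
    next
      case False
      \<comment> \<open>For \<open>p mod 20 = 7\<close> the start 1, \<open>b\<close> gives 1,
        \<open>b\<close>, \<open>b\<close>, 1, 0, so \<open>w 3 + w 4 = 1\<close>, while
        \<open>w 7 = - w 2 = - b\<close> produces the opposite sign recorded in
        \<open>s\<close>.\<close>
      define w where "w = recseq b 1 b"
      have "n = 10 * k + 3" "Suc n = 10 * k + 4" "p = 10 * (2 * k) + 7" using n False p_eq by simp_all
      then have "w n = w 3" "w (Suc n) = w 4" "w p = w 7" unfolding w_def using anti by metis+
      moreover have "w 7 = - w 2" using anti5[of 1 b 2] by (simp add: w_def)
      ultimately have "w n + w (Suc n) = 1" "w 0 + w p = 1 - b"
        by (simp_all add: w_def numeral_eq_Suc algebra_simps bb)
      then show ?thesis using recseq_real[OF ex(1,3,2)] False by (simp add: w_def s_def)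
    qed
  qed
  have "[5 ^ (n div 2) * lucV 1 n = s] (mod P)" by (rule lucV_1_cong[OF odd w])
  then have "[(5 ^ (n div 2) * lucV 1 n) ^ n = s ^ n] (mod P)" by (rule cong_pow)
  moreover have "(5 ^ (n div 2) * lucV (1::int) n) ^ n = (5 ^ n) ^ (n div 2) * lucV 1 n ^ n"
    unfolding power_mult_distrib by (simp only: mult.commute flip: power_mult)
  moreover have "[(5 ^ n) ^ (n div 2) * lucV 1 n ^ n = (-1) ^ (n div 2) * lucV 1 n ^ n] (mod P)"
    by (intro cong_mult cong_pow five cong_refl)
  ultimately have "[(-1) ^ (n div 2) * lucV 1 n ^ n = s ^ n] (mod P)" by (metis cong_sym cong_trans)
  \<comment> \<open>The multiplier cancels the sign left by \<open>5^n = -1\<close> and supplies the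
    minus sign of \<open>T_odd_nonres\<close>.\<close>
  then have "[- ((-1) ^ (n div 2)) * ((-1) ^ (n div 2) * lucV 1 n ^ n) = - ((-1) ^ (n div 2)) * s ^ n] (mod P)"
    by (rule cong_scalar_left)
  moreover have "- ((-1) ^ (n div 2)) * ((-1) ^ (n div 2) * lucV 1 n ^ n) = - (lucV 1 n ^ n :: int)"
    by (simp flip: mult.assoc power_mult_distrib)
  moreover have "- ((-1) ^ (n div 2)) * s ^ n = (-1) ^ (k + 1)"
  proof -
    have "n div 2 = 5 * k + (if p mod 20 = 3 then 0 else 1)" using n by auto
    then show ?thesis using odd by (cases "p mod 20 = 3"; cases "even k") (simp_all add: s_def)
  qed
  moreover have "[T p 1 (- 1) (-1) = - (lucV 1 n ^ n)] (mod P)"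
    using T_odd_nonres[OF odd _ nQR] p_gt_2 by simp
  ultimately show ?thesis using cong_trans unfolding k_def by metis
qed

end

text \<open>The exponent can be -1, as for \<open>p = 3\<close>; only its parity matters.\<close>

lemma neg1_pow_eq: "neg1_pow k = (if even k then 1 else -1)"
  by (simp add: neg1_pow_def even_nat_iff)

section \<open>The residue classes of \<open>p\<close> modulo 20 and modulo 8\<close>

theorem theorem1p5:
  fixes p :: nat
  assumes "prime p" and "odd p"
  shows "(p mod 20 \<in> {1, 9} \<longrightarrow> [T p 1 (-1) (-1) = - (5 ^ ((p - 1) div 4))] (mod int p))
       \<and> (p mod 20 \<in> {13, 17} \<longrightarrow> [T p 1 (-1) (-1) = (-5) ^ ((p - 1) div 4)] (mod int p))
       \<and> (p mod 20 \<in> {3, 7} \<longrightarrow>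
            [T p 1 (-1) (-1) = neg1_pow \<lfloor>(real p - 10) / 20\<rfloor>] (mod int p))
       \<and> (p mod 20 \<in> {11, 19} \<longrightarrow>
            [T p 1 (-1) (-1) = neg1_pow \<lfloor>(real p - 5) / 10\<rfloor>] (mod int p))
       \<and> (p mod 8 = 1 \<longrightarrow> [T p 1 (-2) (-1) = - (2 ^ ((p - 1) div 4))] (mod int p))
       \<and> (p mod 8 = 5 \<longrightarrow> [T p 1 (-2) (-1) = 2 ^ ((p - 1) div 4)] (mod int p))
       \<and> (p mod 8 = 3 \<longrightarrow> [T p 1 (-2) (-1) = (-1) ^ ((p - 3) div 8)] (mod int p))
       \<and> (p mod 8 = 7 \<longrightarrow> [T p 1 (-2) (-1) = (-1) ^ ((p - 7) div 8)] (mod int p))"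
proof -
  obtain n where n: "p = 2 * n + 1" using assms(2) by (rule oddE)
  interpret odd_prime p n using assms(1) n by unfold_locales
  have half: "n div 2 = (p - 1) div 4" using n by simp
  have R: "1 \<in> R" "2 \<in> R" using p_gt_2 by auto
  have "real (20 * (p div 20) + p mod 20) = real p" by simp
  then have real_p: "real p = 20 * real (p div 20) + real (p mod 20)"
    by (simp only: of_nat_add of_nat_mult of_nat_numeral)
  have mod5: "p mod 5 = (p mod 20) mod 5" by (simp add: mod_mod_cancel)
  have n8: "\<not> P dvd 2^2 + 4" using not_dvd_power_2[of 3] by simp
  have n5: "\<not> P dvd 1^2 + 4" if "p \<noteq> 5"
    using not_dvd_5[OF that] by simp
  \<comment> \<open>Writing 8 as \<open>2 * 2^2\<close> splits off the character \<open>2^n\<close>,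
    which decides the sign in the classes 1 and 5 modulo 8.\<close>
  have eight: "(2^2 + 4) ^ (n div 2) = 2 ^ (n div 2) * (2 ^ n :: int)" if "even n"
  proof -
    have "(2^2 + 4 :: int) ^ (n div 2) = (2 * 2^2) ^ (n div 2)" by simp
    also have "\<dots> = 2 ^ (n div 2) * 2 ^ (2 * (n div 2))" by (simp only: power_mult_distrib power_mult)
    finally show ?thesis using that by simp
  qed
  have case1: "[T p 1 (-1) (-1) = - (5 ^ ((p - 1) div 4))] (mod P)" if c: "p mod 20 \<in> {1, 9}"
  proof -
    have "even n" using c n by (auto; presburger)
    moreover have "p mod 5 \<in> {1, 4}" "p \<noteq> 5" using c mod5 by auto
    then have "QuadRes P (1^2 + 4)" using QuadRes_5 by simp
    ultimately show ?thesis using T_even_res[OF _ R(1) n5] \<open>p \<noteq> 5\<close> unfolding half by simp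
  qed
  have case2: "[T p 1 (-1) (-1) = (-5) ^ ((p - 1) div 4)] (mod P)" if c: "p mod 20 \<in> {13, 17}"
  proof -
    have "even n" using c n by (auto; presburger)
    moreover have "p mod 5 \<notin> {1, 4}" "p \<noteq> 5" using c mod5 by auto
    then have "\<not> QuadRes P (1^2 + 4)" using QuadRes_5 by simp
    ultimately show ?thesis using T_even_nonres[OF _ R(1)] unfolding half
      by (simp flip: power_mult_distrib)
  qed
  have case3: "[T p 1 (-1) (-1) = neg1_pow \<lfloor>(real p - 10) / 20\<rfloor>] (mod P)" if c: "p mod 20 \<in> {3, 7}"
  proof -
    \<comment> \<open>The remainder \<open>p mod 20\<close> is below 10, so the floor drops by one
      from \<open>p div 20\<close>.\<close>
    have "\<lfloor>(real p - 10) / 20\<rfloor> = int (p div 20) - 1"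
      using c real_p by (intro floor_unique) auto
    then have "neg1_pow \<lfloor>(real p - 10) / 20\<rfloor> = (-1) ^ (p div 20 + 1)"
      by (simp add: neg1_pow_eq)
    then show ?thesis using T_1_nonres[OF c] by simp
  qed
  have case4: "[T p 1 (-1) (-1) = neg1_pow \<lfloor>(real p - 5) / 10\<rfloor>] (mod P)" if c: "p mod 20 \<in> {11, 19}"
  proof -
    have "\<lfloor>(real p - 5) / 10\<rfloor> = 2 * int (p div 20) + (if p mod 20 = 11 then 0 else 1)"
      using c real_p by (intro floor_unique) auto
    then have "neg1_pow \<lfloor>(real p - 5) / 10\<rfloor> = (if p mod 5 = 1 then 1 else -1)"
      using c mod5 by (auto simp: neg1_pow_eq)
    moreover have "odd n" using c n by (auto; presburger)
    moreover have "p mod 5 \<in> {1, 4}" using c mod5 by auto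
    ultimately show ?thesis using T_1_res by simp
  qed
  have case5: "[T p 1 (-2) (-1) = - (2 ^ ((p - 1) div 4))] (mod P)" if c: "p mod 8 = 1"
  proof -
    have e: "even n" and "even ((n + 1) div 2)" using c n by presburger+
    then have two: "[2 ^ n = 1] (mod P)" using power_2 by simp
    then have "QuadRes P (2^2 + 4)" using QuadRes_8 by simp
    then have "[T p 1 (- 2) (-1) = - (2 ^ (n div 2) * 2 ^ n)] (mod P)"
      using T_even_res[OF e R(2) n8] eight[OF e] by simp
    also have "[- (2 ^ (n div 2) * 2 ^ n) = - (2 ^ (n div 2) * 1)] (mod P)"
      unfolding cong_minus_minus_iff using two by (rule cong_scalar_left)
    finally show ?thesis by (simp add: half)
  qed
  have case6: "[T p 1 (-2) (-1) = 2 ^ ((p - 1) div 4)] (mod P)" if c: "p mod 8 = 5"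
  proof -
    have e: "even n" "odd (n div 2)" and "odd ((n + 1) div 2)" using c n by presburger+
    then have two: "[2 ^ n = -1] (mod P)" using power_2 by simp
    then have "\<not> [2 ^ n = 1] (mod P)" using not_cong_1_neg_1 cong_trans cong_sym by blast
    then have "\<not> QuadRes P (2^2 + 4)" using QuadRes_8 by simp
    then have "[T p 1 (- 2) (-1) = - (2 ^ (n div 2) * 2 ^ n)] (mod P)"
      using T_even_nonres[OF e(1) R(2)] eight[OF e(1)] e(2) by simp
    also have "[- (2 ^ (n div 2) * 2 ^ n) = - (2 ^ (n div 2) * -1)] (mod P)"
      unfolding cong_minus_minus_iff using two by (rule cong_scalar_left)
    finally show ?thesis by (simp add: half)
  qed
  show ?thesis
    using case1 case2 case3 case4 case5 case6 T_2_mod_8_3 T_2_mod_8_7 by blast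
qed

end
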